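(* Let $k\ge 1$ and $L>0$. Let $F_k$ be the geodesic space formed by attaching $2k+2$ edges of length $L$ to $\mathbb S^k$ at the vertices of the regular cross-polytope. Then $\mathbb S^k$ and $F_k$ have the same (Vietoris-Rips) persistence diagrams (in every degree), but $D^{\mathrm{VR}}_{2k+2,k}(\mathbb S^k)\subsetneq D^{\mathrm{VR}}_{2k+2,k}(F_k)$.
   Context: $\mathbb S^k\subset\mathbb R^{k+1}$ is the unit sphere with its geodesic distance. The vertices of the regular cross-polytope are $\pm e_1,\dots,\pm e_{k+1}$. $F_k$ is the metric gluing: one endpoint of a segment $[0,L]$ is identified with each of these $2k+2$ points (one segment per vertex), and $F_k$ carries the resulting path metric. For a metric space $Y$ and $r\ge 0$, $\mathrm{VR}_r(Y)$ is the simplicial complex of nonempty finite subsets $\sigma\subset Y$ with $\mathrm{diam}(\sigma)\le r$. With a fixed coefficient field $\mathbb F$, the degree $j$ Vietoris-Rips persistence diagram $\mathrm{dgm}_j^{\mathrm{VR}}(Y)$ of a compact metric space is the persistence diagram of the (q-tame) persistence module $r\mapsto\widetilde H_j(\mathrm{VR}_r(Y);\mathbb F)$; for finite $Y$ it is the multiset of points $(b_\alpha,d_\alpha)$ where the module is the direct sum of interval modules on $[b_\alpha,d_\alpha)$. $D^{\mathrm{VR}}_{2k+2,k}(X):=\{\mathrm{dgm}_k^{\mathrm{VR}}(X'):X'\subset X,\ |X'|\le 2k+2\}$. *)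

theory Defs
  imports
    "HOL-Analysis.Abstract_Euclidean_Space"
    "HOL-Library.Extended_Real"
    "HOL-Library.Poly_Mapping"
    "HOL-Library.Set_Algebras"
    "HOL-Combinatorics.Permutations"
    "Jordan_Normal_Form.VS_Connect"
begin

section \<open>Simplicial homology with field coefficients\<close>

text \<open>
  A simplicial complex is a set of finite nonempty vertex sets. An oriented \<open>j\<close>-chain is a finitely
  supported function on the ordered \<open>j\<close>-simplices (lists of \<open>j + 1\<close> distinct vertices spanning a
  simplex) that changes by the sign of the permutation when the vertices are reordered. The
  elementary chain of \<open>[x\<^sub>0, \<dots>, x\<^sub>j]\<close> is thus the function with value \<open>sign p\<close> at the list permuted
  by \<open>p\<close>, and \<open>0\<close> at all other lists.
\<close>

type_synonym ('a, 'f) chain = "'a list \<Rightarrow>\<^sub>0 'f"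

definition oriented_chains :: "'a set set \<Rightarrow> nat \<Rightarrow> ('a, 'f::field) chain set" where
  "oriented_chains K j =
     {c. (\<forall>xs \<in> Poly_Mapping.keys c. length xs = Suc j \<and> distinct xs \<and> set xs \<in> K) \<and>
         (\<forall>xs p. p permutes {..<length xs} \<longrightarrow>
            Poly_Mapping.lookup c (permute_list p xs) = of_int (sign p) * Poly_Mapping.lookup c xs)}"

text \<open>
  The coefficient of the boundary at \<open>ys\<close> is the sum over \<open>y\<close> of the coefficients at \<open>y # ys\<close>. On
  the elementary chain of \<open>[x\<^sub>0, \<dots>, x\<^sub>j]\<close> this is the alternating sum of the faces, since moving
  \<open>x\<^sub>i\<close> to the front has sign \<open>(-1) ^ i\<close>. On a \<open>0\<close>-chain it is the augmentation (the coefficient sum,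
  placed at the empty list), so the homology below is reduced in degree \<open>0\<close>.
\<close>

definition boundary :: "('a, 'f::field) chain \<Rightarrow> ('a, 'f) chain" where
  "boundary c = (\<Sum>xs \<in> Poly_Mapping.keys c. Poly_Mapping.single (tl xs) (Poly_Mapping.lookup c xs))"

definition cycles :: "'a set set \<Rightarrow> nat \<Rightarrow> ('a, 'f::field) chain set" where
  "cycles K j = {c \<in> oriented_chains K j. boundary c = 0}"

definition boundaries :: "'a set set \<Rightarrow> nat \<Rightarrow> ('a, 'f::field) chain set" where
  "boundaries K j = boundary ` oriented_chains K (Suc j)"

text \<open>
  The quotient of cycles by boundaries; its elements are cosets. The components \<open>mult\<close> and \<open>one\<close>
  of the record have no meaning for a vector space.
\<close>

definition reduced_homology :: "'a set set \<Rightarrow> nat \<Rightarrow> ('f::field, ('a, 'f) chain set) module" where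
  "reduced_homology K j =
     \<lparr>carrier = {z +o boundaries K j | z. z \<in> cycles K j},
      mult = undefined, one = undefined,
      zero = boundaries K j,
      add = (\<lambda>A B. A + B),
      smult = (\<lambda>r A. Poly_Mapping.map ((*) r) ` A + boundaries K j)\<rparr>"

text \<open>The map induced by the inclusion of a subcomplex into \<open>K\<close>: it sends \<open>z + B\<close> to \<open>z + B\<^sub>K\<close>.\<close>

definition homology_inclusion ::
  "'a set set \<Rightarrow> nat \<Rightarrow> ('a, 'f::field) chain set \<Rightarrow> ('a, 'f) chain set" where
  "homology_inclusion K j A = A + boundaries K j"


section \<open>Persistence diagrams\<close>

text \<open>
  A persistence module is given by vector spaces \<open>V t\<close> and maps \<open>\<phi> s t\<close> from \<open>V s\<close> to \<open>V t\<close> for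
  \<open>s \<le> t\<close>. By convention \<open>V \<infinity> = 0\<close>.
\<close>

definition persistence_rank ::
  "(real \<Rightarrow> ('f::field, 'v) module) \<Rightarrow> (real \<Rightarrow> real \<Rightarrow> 'v \<Rightarrow> 'v) \<Rightarrow> real \<Rightarrow> ereal \<Rightarrow> nat" where
  "persistence_rank V \<phi> s t =
     (if t = \<infinity> then 0
      else vectorspace.dim class_ring
        (V (real_of_ereal t)\<lparr>carrier := \<phi> s (real_of_ereal t) ` carrier (V s)\<rparr>))"

text \<open>
  The persistence measure of Chazal, de Silva, Glisse and Oudot: for a direct sum of interval
  modules, the number of intervals that are born in \<open>]a, b]\<close> and die in \<open>]c, d]\<close> (up to the
  endpoint conventions). The diagram of a q-tame module has as multiplicity at a point \<open>(p, q)\<close>,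
  \<open>p < q \<le> \<infinity>\<close>, the minimum of the measures of the rectangles \<open>[a, b] \<times> [c, d]\<close> containing the
  point in their interior, where \<open>q = d = \<infinity>\<close> counts as interior. All ranks that
  occur are between distinct parameters, hence finite for a q-tame module. A diagram is encoded
  by its multiplicity function, because it need not be finite as a multiset.
\<close>

definition persistence_measure ::
  "(real \<Rightarrow> ('f::field, 'v) module) \<Rightarrow> (real \<Rightarrow> real \<Rightarrow> 'v \<Rightarrow> 'v) \<Rightarrow>
     real \<Rightarrow> real \<Rightarrow> real \<Rightarrow> ereal \<Rightarrow> int" where
  "persistence_measure V \<phi> a b c d =
     int (persistence_rank V \<phi> b (ereal c)) - int (persistence_rank V \<phi> a (ereal c))
     - int (persistence_rank V \<phi> b d) + int (persistence_rank V \<phi> a d)"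

definition persistence_diagram ::
  "(real \<Rightarrow> ('f::field, 'v) module) \<Rightarrow> (real \<Rightarrow> real \<Rightarrow> 'v \<Rightarrow> 'v) \<Rightarrow> real \<times> ereal \<Rightarrow> nat" where
  "persistence_diagram V \<phi> = (\<lambda>(p, q).
     if ereal p < q
     then Inf {nat (persistence_measure V \<phi> a b c d) | a b c d.
                 a < p \<and> p < b \<and> b < c \<and> ereal c < q \<and> (q < d \<or> d = \<infinity>)}
     else 0)"


section \<open>Vietoris-Rips persistence\<close>

definition vietoris_rips :: "'a set \<Rightarrow> ('a \<Rightarrow> 'a \<Rightarrow> real) \<Rightarrow> real \<Rightarrow> 'a set set" where
  "vietoris_rips M d r =
     {\<sigma>. finite \<sigma> \<and> \<sigma> \<noteq> {} \<and> \<sigma> \<subseteq> M \<and> (\<forall>x\<in>\<sigma>. \<forall>y\<in>\<sigma>. d x y \<le> r)}"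

text \<open>
  The module is indexed by all reals; for \<open>r < 0\<close> the Vietoris-Rips complex is empty and the
  homology vanishes in every degree \<open>j \<ge> 0\<close>.
\<close>

definition dgm_VR ::
  "'f::field itself \<Rightarrow> nat \<Rightarrow> 'a set \<Rightarrow> ('a \<Rightarrow> 'a \<Rightarrow> real) \<Rightarrow> real \<times> ereal \<Rightarrow> nat" where
  "dgm_VR _ j M d =
     persistence_diagram
       (\<lambda>r. reduced_homology (vietoris_rips M d r) j :: ('f, ('a, 'f) chain set) module)
       (\<lambda>s t. homology_inclusion (vietoris_rips M d t) j)"

definition persistence_set ::
  "'f::field itself \<Rightarrow> nat \<Rightarrow> nat \<Rightarrow> 'a set \<Rightarrow> ('a \<Rightarrow> 'a \<Rightarrow> real) \<Rightarrow> (real \<times> ereal \<Rightarrow> nat) set" where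
  "persistence_set F n j M d =
     {dgm_VR F j X' d | X'. X' \<subseteq> M \<and> finite X' \<and> card X' \<le> n}"


section \<open>The sphere with edges attached at the vertices of the cross-polytope\<close>

definition sphere_geodesic :: "nat \<Rightarrow> (nat \<Rightarrow> real) \<Rightarrow> (nat \<Rightarrow> real) \<Rightarrow> real" where
  "sphere_geodesic k x y = arccos (\<Sum>i\<le>k. x i * y i)"

definition cross_polytope_vertices :: "nat \<Rightarrow> (nat \<Rightarrow> real) set" where
  "cross_polytope_vertices k =
     {(\<lambda>j. if j = i then s else 0) | i s. i \<le> k \<and> (s = 1 \<or> s = -1)}"

text \<open>
  Attaching a copy of \<open>[0, L]\<close> at each \<open>v \<in> P \<subseteq> M\<close>: the glued set consists of the pairs \<open>(x, 0)\<close>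
  with \<open>x \<in> M\<close> and \<open>(v, t)\<close> with \<open>v \<in> P\<close>, \<open>0 \<le> t \<le> L\<close>, the endpoint \<open>0\<close> of the segment at \<open>v\<close> being
  identified with \<open>v\<close>. Its pieces are \<open>M\<close> and the segments, and the gluing metric is the infimum
  of the lengths of chains of points in which consecutive points lie in a common piece. When the
  pieces are length spaces this is the path metric.
\<close>

definition attach_edges :: "'a set \<Rightarrow> 'a set \<Rightarrow> real \<Rightarrow> ('a \<times> real) set" where
  "attach_edges M P L = {(x, t). x \<in> M \<and> (t = 0 \<or> x \<in> P \<and> 0 \<le> t \<and> t \<le> L)}"

definition same_piece :: "'a \<times> real \<Rightarrow> 'a \<times> real \<Rightarrow> bool" where
  "same_piece p q \<longleftrightarrow> fst p = fst q \<or> snd p = 0 \<and> snd q = 0"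

definition piece_dist :: "('a \<Rightarrow> 'a \<Rightarrow> real) \<Rightarrow> 'a \<times> real \<Rightarrow> 'a \<times> real \<Rightarrow> real" where
  "piece_dist d p q = (if fst p = fst q then \<bar>snd p - snd q\<bar> else d (fst p) (fst q))"

definition attach_edges_dist ::
  "'a set \<Rightarrow> ('a \<Rightarrow> 'a \<Rightarrow> real) \<Rightarrow> 'a set \<Rightarrow> real \<Rightarrow> 'a \<times> real \<Rightarrow> 'a \<times> real \<Rightarrow> real" where
  "attach_edges_dist M d P L p q =
     Inf {(\<Sum>i < length zs - 1. piece_dist d (zs ! i) (zs ! Suc i)) | zs.
            zs \<noteq> [] \<and> hd zs = p \<and> last zs = q \<and> set zs \<subseteq> attach_edges M P L \<and>
            successively same_piece zs}"

abbreviation unit_sphere :: "nat \<Rightarrow> (nat \<Rightarrow> real) set" where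
  "unit_sphere k \<equiv> topspace (nsphere k)"

definition spiked_sphere :: "nat \<Rightarrow> real \<Rightarrow> ((nat \<Rightarrow> real) \<times> real) set" where
  "spiked_sphere k L = attach_edges (unit_sphere k) (cross_polytope_vertices k) L"

definition spiked_sphere_dist ::
  "nat \<Rightarrow> real \<Rightarrow> (nat \<Rightarrow> real) \<times> real \<Rightarrow> (nat \<Rightarrow> real) \<times> real \<Rightarrow> real" where
  "spiked_sphere_dist k L =
     attach_edges_dist (unit_sphere k) (sphere_geodesic k) (cross_polytope_vertices k) L"

end

theory Submission
  imports Defs
begin

text \<open>
  An attached edge does not change the persistent homology, because the topmost vertex of a cycle can
  be lowered along its edge in steps of length at most the scale \<open>s\<close>, each of which changes the cycle by
  a boundary in the same Vietoris-Rips complex (for \<open>s = 0\<close>, in a larger one). So every cycle is homologous to one in the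
  sphere, and bounding chains are pushed down likewise; hence the ranks between distinct parameters, which
  determine the diagram, agree. The free ends of the edges, however, form a metric space of
  \<open>2 k + 2\<close> points, with distances \<open>\<pi> + 2 L\<close> between antipodes and \<open>\<pi> / 2 + 2 L\<close> otherwise. Between
  these two scales its Vietoris-Rips complex is the boundary of the cross-polytope, a \<open>k\<close>-sphere, so its
  diagram contains a point with death time \<open>\<pi> + 2 L\<close>. Subsets of the sphere have diameter at most
  \<open>\<pi>\<close>, so that all their classes die by time \<open>\<pi>\<close>.
\<close>

section \<open>Quotients of spaces of chains\<close>

abbreviation scale :: "'f::field \<Rightarrow> ('k \<Rightarrow>\<^sub>0 'f) \<Rightarrow> ('k \<Rightarrow>\<^sub>0 'f)" where
  "scale r \<equiv> Poly_Mapping.map ((*) r)"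

lemma lookup_scale [simp]: "Poly_Mapping.lookup (scale r c) x = r * Poly_Mapping.lookup c x"
  by (transfer fixing: r) (auto simp: when_def)

lemma scale_algebra:
  "scale r (x + y) = scale r x + scale r y" "scale (r + s) x = scale r x + scale s x"
  "scale (r * s) x = scale r (scale s x)" "scale 1 x = x" "scale 0 x = 0" "scale r 0 = 0"
  "scale (-1) x = - x"
  by (rule poly_mapping_eqI; simp add: lookup_add algebra_simps)+

definition linear_subspace :: "('k \<Rightarrow>\<^sub>0 'f::field) set \<Rightarrow> bool" where
  "linear_subspace Z \<longleftrightarrow> 0 \<in> Z \<and> (\<forall>x\<in>Z. \<forall>y\<in>Z. x + y \<in> Z) \<and> (\<forall>r. \<forall>x\<in>Z. scale r x \<in> Z)"

lemma linear_subspaceD: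
  assumes "linear_subspace Z"
  shows "0 \<in> Z" "x \<in> Z \<Longrightarrow> y \<in> Z \<Longrightarrow> x + y \<in> Z" "x \<in> Z \<Longrightarrow> scale r x \<in> Z"
    "x \<in> Z \<Longrightarrow> - x \<in> Z" "x \<in> Z \<Longrightarrow> y \<in> Z \<Longrightarrow> x - y \<in> Z"
proof -
  show neg: "- x \<in> Z" if "x \<in> Z" for x
    using assms that scale_algebra(7)[of x] unfolding linear_subspace_def by metis
  show "x - y \<in> Z" if "x \<in> Z" "y \<in> Z"
    using assms that(1) neg[OF that(2)] unfolding linear_subspace_def
    by (metis diff_conv_add_uminus)
qed (use assms in \<open>auto simp: linear_subspace_def\<close>)

definition quotient_space :: "('k \<Rightarrow>\<^sub>0 'f::field) set \<Rightarrow> ('k \<Rightarrow>\<^sub>0 'f) set \<Rightarrow> ('f, ('k \<Rightarrow>\<^sub>0 'f) set) module" where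
  "quotient_space Z B =
     \<lparr>carrier = {z +o B | z. z \<in> Z}, mult = undefined, one = undefined, zero = B,
      add = (\<lambda>A A'. A + A'), smult = (\<lambda>r A. scale r ` A + B)\<rparr>"

abbreviation quotient_dim :: "('k \<Rightarrow>\<^sub>0 'f::field) set \<Rightarrow> ('k \<Rightarrow>\<^sub>0 'f) set \<Rightarrow> nat" where
  "quotient_dim Z B \<equiv> vectorspace.dim class_ring (quotient_space Z B)"

lemma coset_eq_iff:
  fixes B :: "('k \<Rightarrow>\<^sub>0 'f::field) set"
  assumes "linear_subspace B"
  shows "x +o B = y +o B \<longleftrightarrow> x - y \<in> B"
proof
  assume "x +o B = y +o B"
  moreover have "x \<in> x +o B"
    using linear_subspaceD(1)[OF assms] by (auto simp: elt_set_plus_def)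
  ultimately obtain b where "b \<in> B" "x = y + b"
    by (auto simp: elt_set_plus_def)
  then show "x - y \<in> B" by simp
next
  assume d: "x - y \<in> B"
  have "x + b \<in> y +o B" if "b \<in> B" for b
    using linear_subspaceD(2)[OF assms d that]
    by (auto simp: elt_set_plus_def intro!: bexI[of _ "x - y + b"])
  moreover have "y + b \<in> x +o B" if "b \<in> B" for b
    using linear_subspaceD(5)[OF assms that d]
    by (auto simp: elt_set_plus_def intro!: bexI[of _ "b - (x - y)"])
  ultimately show "x +o B = y +o B"
    by (auto simp: elt_set_plus_def)
qed

lemma subspace_plus:
  assumes "linear_subspace B"
  shows "B + B = B"
proof
  show "B + B \<subseteq> B"
    using linear_subspaceD(2)[OF assms] by (auto simp: set_plus_def)
  show "B \<subseteq> B + B"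
    using linear_subspaceD(1)[OF assms] by (force simp: set_plus_def)
qed

lemma subspace_plus_subset:
  assumes "linear_subspace B" "linear_subspace B'" "B \<subseteq> B'"
  shows "B + B' = B'"
proof
  show "B + B' \<subseteq> B'"
    using linear_subspaceD(2)[OF assms(2)] assms(3) by (auto simp: set_plus_def)
  show "B' \<subseteq> B + B'"
    using linear_subspaceD(1)[OF assms(1)] by (force simp: set_plus_def)
qed

lemma coset_add:
  assumes "linear_subspace B"
  shows "(x +o B) + (y +o B) = (x + y) +o B"
  using set_plus_rearrange[of x B y B] subspace_plus[OF assms] by simp

lemma coset_image_add:
  assumes "linear_subspace B" "linear_subspace B'" "\<Phi> ` B \<subseteq> B'"
    and add: "\<And>x y. \<Phi> (x + y) = \<Phi> x + \<Phi> y" and 0: "\<Phi> 0 = 0"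
  shows "\<Phi> ` (x +o B) + B' = \<Phi> x +o B'"
proof -
  have "\<Phi> ` (x +o B) = \<Phi> x +o \<Phi> ` B"
    by (force simp: elt_set_plus_def add)
  moreover have "\<Phi> ` B + B' = B'"
  proof
    show "\<Phi> ` B + B' \<subseteq> B'"
      using linear_subspaceD(2)[OF assms(2)] assms(3) by (auto simp: set_plus_def)
    show "B' \<subseteq> \<Phi> ` B + B'"
      using linear_subspaceD(1)[OF assms(1)] 0 by (force simp: set_plus_def)
  qed
  ultimately show ?thesis
    by (simp add: set_plus_rearrange3)
qed

lemma coset_scale:
  assumes "linear_subspace B"
  shows "scale r ` (x +o B) + B = scale r x +o B"
  by (rule coset_image_add[OF assms assms])
    (use linear_subspaceD(3)[OF assms] scale_algebra in auto)

lemma vectorspace_quotient_space: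
  fixes Z B :: "('k \<Rightarrow>\<^sub>0 'f::field) set"
  assumes Z: "linear_subspace Z" and B: "linear_subspace B"
  shows "vectorspace class_ring (quotient_space Z B)"
proof -
  note [simp] = coset_add[OF B] coset_scale[OF B] quotient_space_def
  have comm: "abelian_group (quotient_space Z B)"
  proof (rule abelian_groupI)
    show "\<zero>\<^bsub>quotient_space Z B\<^esub> \<in> carrier (quotient_space Z B)"
      using linear_subspaceD(1)[OF Z] by (auto intro!: exI[of _ 0])
    fix x y z
    assume x: "x \<in> carrier (quotient_space Z B)" and y: "y \<in> carrier (quotient_space Z B)"
    show "x \<oplus>\<^bsub>quotient_space Z B\<^esub> y \<in> carrier (quotient_space Z B)"
      using x y linear_subspaceD(2)[OF Z] by auto
    show "x \<oplus>\<^bsub>quotient_space Z B\<^esub> y = y \<oplus>\<^bsub>quotient_space Z B\<^esub> x"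
      by (simp add: add.commute)
    show "x \<oplus>\<^bsub>quotient_space Z B\<^esub> y \<oplus>\<^bsub>quotient_space Z B\<^esub> z
        = x \<oplus>\<^bsub>quotient_space Z B\<^esub> (y \<oplus>\<^bsub>quotient_space Z B\<^esub> z)"
      by (simp add: add.assoc)
    obtain a where a: "a \<in> Z" "x = a +o B" using x by auto
    show "\<zero>\<^bsub>quotient_space Z B\<^esub> \<oplus>\<^bsub>quotient_space Z B\<^esub> x = x"
      using coset_add[OF B, of 0 a] a by simp
    have "(- a +o B) + x = \<zero>\<^bsub>quotient_space Z B\<^esub>"
      using a by simp
    then show "\<exists>y\<in>carrier (quotient_space Z B). y \<oplus>\<^bsub>quotient_space Z B\<^esub> x = \<zero>\<^bsub>quotient_space Z B\<^esub>"
      using linear_subspaceD(4)[OF Z a(1)] by auto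
  qed
  have "module (class_ring :: 'f ring) (quotient_space Z B)"
  proof (rule moduleI[OF class_cring.is_cring comm])
    fix r s :: 'f and x y :: "('k \<Rightarrow>\<^sub>0 'f) set"
    assume "x \<in> carrier (quotient_space Z B)" "y \<in> carrier (quotient_space Z B)"
    then obtain a b where x: "x = a +o B" "a \<in> Z" and y: "y = b +o B" by auto
    show "r \<odot>\<^bsub>quotient_space Z B\<^esub> x \<in> carrier (quotient_space Z B)"
      using linear_subspaceD(3)[OF Z x(2)] x by auto
    show "r \<odot>\<^bsub>quotient_space Z B\<^esub> (x \<oplus>\<^bsub>quotient_space Z B\<^esub> y)
        = r \<odot>\<^bsub>quotient_space Z B\<^esub> x \<oplus>\<^bsub>quotient_space Z B\<^esub> r \<odot>\<^bsub>quotient_space Z B\<^esub> y"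
      by (simp add: x y flip: scale_algebra)
    show "(r \<oplus>\<^bsub>class_ring\<^esub> s) \<odot>\<^bsub>quotient_space Z B\<^esub> x
        = r \<odot>\<^bsub>quotient_space Z B\<^esub> x \<oplus>\<^bsub>quotient_space Z B\<^esub> s \<odot>\<^bsub>quotient_space Z B\<^esub> x"
      by (simp add: x flip: scale_algebra(2))
    show "(r \<otimes>\<^bsub>class_ring\<^esub> s) \<odot>\<^bsub>quotient_space Z B\<^esub> x
        = r \<odot>\<^bsub>quotient_space Z B\<^esub> (s \<odot>\<^bsub>quotient_space Z B\<^esub> x)"
      by (simp add: x flip: scale_algebra(3))
    show "\<one>\<^bsub>class_ring\<^esub> \<odot>\<^bsub>quotient_space Z B\<^esub> x = x"
      using coset_scale[OF B, of 1 a] by (simp add: x scale_algebra(4) del: coset_scale[OF B])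
  qed
  then show ?thesis
    unfolding vectorspace_def using class_field by blast
qed

lemma (in linear_map) inv_into_linear_map:
  assumes "bij_betw T (carrier V) (carrier W)"
  shows "linear_map K W V (inv_into (carrier V) T)"
proof -
  let ?g = "inv_into (carrier V) T"
  have g: "?g w \<in> carrier V" "T (?g w) = w" if "w \<in> carrier W" for w
    using assms that by (auto simp: bij_betw_def f_inv_into_f inv_into_into)
  have gT: "?g (T v) = v" if "v \<in> carrier V" for v
    using assms that by (auto simp: bij_betw_def)
  have "?g \<in> module_hom K W V"
    unfolding module_hom_def
  proof (intro CollectI conjI allI impI)
    show "?g \<in> carrier W \<rightarrow> carrier V" using g by auto
  next
    fix x y assume xy: "x \<in> carrier W \<and> y \<in> carrier W"
    then have "x \<oplus>\<^bsub>W\<^esub> y = T (?g x \<oplus>\<^bsub>V\<^esub> ?g y)" using g by simp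
    then show "?g (x \<oplus>\<^bsub>W\<^esub> y) = ?g x \<oplus>\<^bsub>V\<^esub> ?g y"
      by (rule trans[OF arg_cong[of _ _ ?g] gT]) (use g xy in simp)
  next
    fix r x assume rx: "r \<in> carrier K \<and> x \<in> carrier W"
    then have "r \<odot>\<^bsub>W\<^esub> x = T (r \<odot>\<^bsub>V\<^esub> ?g x)" using g by simp
    then show "?g (r \<odot>\<^bsub>W\<^esub> x) = r \<odot>\<^bsub>V\<^esub> ?g x"
      by (rule trans[OF arg_cong[of _ _ ?g] gT]) (use g rx in simp)
  qed
  then show ?thesis
    by (intro linear_map.intro mod_hom.intro mod_hom_axioms.intro)
      (unfold_locales)
qed

lemma (in linear_map) dim_eq_of_bij:
  assumes bij: "bij_betw T (carrier V) (carrier W)"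
  shows "V.dim = W.dim"
proof (cases "V.fin_dim")
  case True
  then show ?thesis
    using dim_eq bij by (auto simp: bij_betw_def)
next
  case False
  interpret inv: linear_map K W V "inv_into (carrier V) T"
    by (rule inv_into_linear_map[OF bij])
  have "\<not> W.fin_dim"
    using inv.surj_fin_dim False bij_betw_inv_into[OF bij] by (auto simp: bij_betw_def)
  then show ?thesis
    using False unfolding V.dim_def W.dim_def V.fin_dim_def W.fin_dim_def
    by (metis (no_types, lifting))
qed

lemma quotient_dim_eq:
  fixes \<Phi> :: "('k \<Rightarrow>\<^sub>0 'f::field) \<Rightarrow> ('l \<Rightarrow>\<^sub>0 'f)"
  assumes Z: "linear_subspace Z" and B: "linear_subspace B"
    and Z': "linear_subspace Z'" and B': "linear_subspace B'"
    and add: "\<And>x y. \<Phi> (x + y) = \<Phi> x + \<Phi> y" and scale: "\<And>r x. \<Phi> (scale r x) = scale r (\<Phi> x)"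
    and ZZ': "\<Phi> ` Z \<subseteq> Z'" and BB': "\<Phi> ` B \<subseteq> B'"
    and inj: "\<And>z. z \<in> Z \<Longrightarrow> \<Phi> z \<in> B' \<Longrightarrow> z \<in> B"
    and surj: "\<And>z'. z' \<in> Z' \<Longrightarrow> \<exists>z\<in>Z. z' - \<Phi> z \<in> B'"
  shows "quotient_dim Z B = quotient_dim Z' B'"
proof -
  define T where "T A = \<Phi> ` A + B'" for A
  have 0: "\<Phi> 0 = 0"
    using scale[of 0 0] by (simp add: scale_algebra)
  have diff: "\<Phi> (x - y) = \<Phi> x - \<Phi> y" for x y
    using add[of "x - y" y] by simp
  have T: "T (z +o B) = \<Phi> z +o B'" for z
    unfolding T_def by (rule coset_image_add[OF B B' BB' add 0])
  have lin: "linear_map class_ring (quotient_space Z B) (quotient_space Z' B') T"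
  proof (intro linear_map.intro mod_hom.intro mod_hom_axioms.intro)
    show "T \<in> module_hom class_ring (quotient_space Z B) (quotient_space Z' B')"
      unfolding module_hom_def quotient_space_def using image_subset_iff[THEN iffD1, OF ZZ']
      by (auto simp: T coset_add[OF B] coset_add[OF B'] coset_scale[OF B] coset_scale[OF B'] add scale)
  qed (use vectorspace_quotient_space Z B Z' B' in \<open>auto simp: vectorspace_def\<close>)
  have "bij_betw T (carrier (quotient_space Z B)) (carrier (quotient_space Z' B'))"
    unfolding bij_betw_def
  proof
    show "inj_on T (carrier (quotient_space Z B))"
    proof (rule inj_onI)
      fix x y
      assume "x \<in> carrier (quotient_space Z B)" "y \<in> carrier (quotient_space Z B)" "T x = T y"
      then obtain a b where ab: "a \<in> Z" "b \<in> Z" "x = a +o B" "y = b +o B"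
        by (auto simp: quotient_space_def)
      then have "\<Phi> (a - b) \<in> B'"
        using \<open>T x = T y\<close> coset_eq_iff[OF B'] by (auto simp: T diff)
      then show "x = y"
        using inj linear_subspaceD(5)[OF Z] ab coset_eq_iff[OF B] by blast
    qed
    have "T (z +o B) \<in> carrier (quotient_space Z' B')" if "z \<in> Z" for z
      using ZZ' that unfolding T by (auto simp: quotient_space_def)
    moreover have "z' +o B' \<in> T ` carrier (quotient_space Z B)" if z': "z' \<in> Z'" for z'
    proof -
      obtain z where "z \<in> Z" "z' +o B' = T (z +o B)"
        using surj[OF z'] unfolding T coset_eq_iff[OF B'] by blast
      then show ?thesis
        by (auto simp: quotient_space_def)
    qed
    ultimately show "T ` carrier (quotient_space Z B) = carrier (quotient_space Z' B')"
      by (auto simp: quotient_space_def)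
  qed
  then show ?thesis
    using linear_map.dim_eq_of_bij[OF lin] by simp
qed

lemma quotient_dim_eq_0:
  assumes Z: "linear_subspace Z" and B: "linear_subspace B" and "Z \<subseteq> B"
  shows "quotient_dim Z B = 0"
proof -
  interpret V: vectorspace class_ring "quotient_space Z B"
    by (rule vectorspace_quotient_space[OF Z B])
  have "carrier (quotient_space Z B) = {\<zero>\<^bsub>quotient_space Z B\<^esub>}"
  proof -
    have "z +o B = 0 +o B" if "z \<in> Z" for z
      using coset_eq_iff[OF B, of z 0] \<open>Z \<subseteq> B\<close> that by auto
    then show ?thesis
      using linear_subspaceD(1)[OF Z] by (auto simp: quotient_space_def)
  qed
  then have "V.gen_set {\<zero>\<^bsub>quotient_space Z B\<^esub>}"
    using V.in_own_span[of "{\<zero>\<^bsub>quotient_space Z B\<^esub>}"] V.span_is_subset2[of "{\<zero>\<^bsub>quotient_space Z B\<^esub>}"] by auto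
  then show ?thesis
    by (rule V.dim0I)
qed

lemma quotient_dim_eq_1:
  assumes Z: "linear_subspace Z" and B: "linear_subspace B"
    and \<phi>: "\<phi> \<in> Z" "\<phi> \<notin> B" and gen: "\<And>z. z \<in> Z \<Longrightarrow> \<exists>r. z - scale r \<phi> \<in> B"
  shows "quotient_dim Z B = 1"
proof -
  interpret V: vectorspace class_ring "quotient_space Z B"
    by (rule vectorspace_quotient_space[OF Z B])
  have c: "\<phi> +o B \<in> carrier (quotient_space Z B)"
    using \<phi> by (auto simp: quotient_space_def)
  show ?thesis
  proof (rule V.dim1I[of "\<phi> +o B"])
    show "\<phi> +o B \<noteq> \<zero>\<^bsub>quotient_space Z B\<^esub>"
      using coset_eq_iff[OF B, of \<phi> 0] \<phi> by (simp add: quotient_space_def)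
    show "\<phi> +o B \<in> carrier (quotient_space Z B)" by (fact c)
    have "x \<in> V.span {\<phi> +o B}" if x: "x \<in> carrier (quotient_space Z B)" for x
    proof -
      obtain z where z: "z \<in> Z" "x = z +o B"
        using x by (auto simp: quotient_space_def)
      obtain r where "z - scale r \<phi> \<in> B"
        using gen z by blast
      then have "x = r \<odot>\<^bsub>quotient_space Z B\<^esub> (\<phi> +o B)"
        using z coset_eq_iff[OF B] coset_scale[OF B] by (simp add: quotient_space_def)
      moreover have "\<phi> +o B \<in> V.span {\<phi> +o B}"
        using V.in_own_span[of "{\<phi> +o B}"] c by auto
      ultimately show ?thesis
        using V.span_is_submodule[of "{\<phi> +o B}"] c
        by (simp add: submodule.smult_closed class_ring_simps)
    qed
    then show "V.gen_set {\<phi> +o B}"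
      using V.span_is_subset2[of "{\<phi> +o B}"] c by auto
  qed
qed

section \<open>Alternating functions on lists\<close>

definition alternating :: "('a list \<Rightarrow> 'f::field) \<Rightarrow> bool" where
  "alternating f \<longleftrightarrow> (\<forall>us a b vs. f (us @ a # b # vs) = - f (us @ b # a # vs)) \<and>
     (\<forall>us a vs. f (us @ a # a # vs) = 0)"

lemma alternatingD:
  assumes "alternating f"
  shows "f (us @ a # b # vs) = - f (us @ b # a # vs)" "f (us @ a # a # vs) = 0"
    "f (a # b # vs) = - f (b # a # vs)" "f (a # a # vs) = 0"
proof -
  show *: "f (us @ a # b # vs) = - f (us @ b # a # vs)" "f (us @ a # a # vs) = 0" for us
    by (rule assms[unfolded alternating_def, THEN conjunct1, rule_format],
        rule assms[unfolded alternating_def, THEN conjunct2, rule_format])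
  show "f (a # b # vs) = - f (b # a # vs)" "f (a # a # vs) = 0"
    using *[of "[]"] by simp_all
qed

lemma alternating_Cons:
  assumes "alternating f"
  shows "alternating (\<lambda>xs. f (x # xs))"
  unfolding alternating_def
proof (intro conjI allI)
  show "f (x # us @ a # b # vs) = - f (x # us @ b # a # vs)" "f (x # us @ a # a # vs) = 0" for us a b vs
    using alternatingD(1)[OF assms, of "x # us" a b vs] alternatingD(2)[OF assms, of "x # us" a vs]
    by simp_all
qed

lemma alternating_swap:
  assumes "alternating f"
  shows "f (us @ a # ws @ b # vs) = - f (us @ b # ws @ a # vs)"
proof (induction ws arbitrary: us)
  case Nil
  show ?case using alternatingD(1)[OF assms, of us a b vs] by simp
next
  case (Cons w ws)
  have "f (us @ a # (w # ws) @ b # vs) = - f ((us @ [w]) @ a # ws @ b # vs)"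
    using alternatingD(1)[OF assms, of us a w "ws @ b # vs"] by simp
  also have "\<dots> = f (us @ w # b # ws @ a # vs)"
    using Cons[of "us @ [w]"] by simp
  also have "\<dots> = - f (us @ b # (w # ws) @ a # vs)"
    using alternatingD(1)[OF assms, of us w b "ws @ a # vs"] by simp
  finally show ?case .
qed

lemma alternating_repeat:
  assumes "alternating f"
  shows "f (us @ a # ws @ a # vs) = 0"
proof (induction ws arbitrary: us)
  case Nil
  show ?case using alternatingD(2)[OF assms] by simp
next
  case (Cons w ws)
  have "f (us @ a # (w # ws) @ a # vs) = - f ((us @ [w]) @ a # ws @ a # vs)"
    using alternatingD(1)[OF assms, of us a w "ws @ a # vs"] by simp
  then show ?case using Cons[of "us @ [w]"] by simp
qed

lemma alternating_distinct:
  assumes "alternating f" "f xs \<noteq> 0"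
  shows "distinct xs"
proof (rule ccontr)
  assume "\<not> distinct xs"
  then obtain us a ws vs where "xs = us @ [a] @ ws @ [a] @ vs"
    using not_distinct_decomp by blast
  then show False
    using alternating_repeat[OF assms(1)] assms(2) by simp
qed

lemma permute_list_transpose:
  "permute_list (Transposition.transpose (length us) (length us + Suc (length ws))) (us @ a # ws @ b # vs)
     = us @ b # ws @ a # vs"
proof (rule nth_equalityI)
  fix i
  assume "i < length (permute_list (Transposition.transpose (length us) (length us + Suc (length ws))) (us @ a # ws @ b # vs))"
  then have i: "i < length (us @ a # ws @ b # vs)" by simp
  have p: "Transposition.transpose (length us) (length us + Suc (length ws)) permutes {..<length (us @ a # ws @ b # vs)}"
    by (rule permutes_swap_id) auto
  consider "i = length us" | "i = length us + Suc (length ws)" | "i \<noteq> length us" "i \<noteq> length us + Suc (length ws)"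
    by blast
  then show "permute_list (Transposition.transpose (length us) (length us + Suc (length ws))) (us @ a # ws @ b # vs) ! i
      = (us @ b # ws @ a # vs) ! i"
  proof cases
    case 3
    then have "(us @ a # ws @ b # vs) ! i = (us @ b # ws @ a # vs) ! i"
      by (auto simp: nth_append nth_Cons split: nat.splits)
    then show ?thesis
      using 3 by (subst permute_list_nth[OF p i]) (simp add: transpose_def)
  qed (subst permute_list_nth[OF p i], simp add: transpose_def nth_append)+
qed simp

lemma alternating_transpose:
  assumes f: "alternating f" and "i < length xs" "j < length xs" "i \<noteq> j"
  shows "f (permute_list (Transposition.transpose i j) xs) = - f xs"
proof -
  have *: "f (permute_list (Transposition.transpose i j) xs) = - f xs" if "i < j" "j < length xs" for i j
  proof -
    define us ws vs where "us = take i xs" and "ws = take (j - Suc i) (drop (Suc i) xs)"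
      and "vs = drop (Suc j) xs"
    have "drop (Suc i) xs = ws @ drop (j - Suc i) (drop (Suc i) xs)"
      unfolding ws_def by (simp only: append_take_drop_id)
    also have "drop (j - Suc i) (drop (Suc i) xs) = drop j xs"
      using that by simp
    also have "\<dots> = xs ! j # vs"
      using that by (simp add: vs_def Cons_nth_drop_Suc)
    finally have xs: "xs = us @ xs ! i # ws @ xs ! j # vs"
      using id_take_nth_drop[of i xs] that by (simp add: us_def)
    have l: "i = length us" "j = length us + Suc (length ws)"
      using that by (auto simp: us_def ws_def)
    have "f (permute_list (Transposition.transpose i j) xs) = f (us @ xs ! j # ws @ xs ! i # vs)"
      using permute_list_transpose[of us ws "xs ! i" "xs ! j" vs] l xs by simp
    then show ?thesis
      using alternating_swap[OF f, of us "xs ! j" ws "xs ! i" vs] xs by simp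
  qed
  show ?thesis
    using *[of i j] *[of j i] assms by (metis linorder_neqE_nat transpose_commute)
qed

lemma alternating_permute:
  assumes f: "alternating f" and p: "p permutes {..<length xs}"
  shows "f (permute_list p xs) = of_int (sign p) * f xs"
  using finite_lessThan p
proof (induction rule: permutes_rev_induct)
  case (swap a b p)
  have t: "Transposition.transpose a b permutes {..<length xs}"
    using swap by (intro permutes_swap_id) auto
  have 1: "f (permute_list (p \<circ> Transposition.transpose a b) xs) = - f (permute_list p xs)"
    using alternating_transpose[OF f, of a "permute_list p xs" b] swap
    by (simp add: permute_list_compose[OF t])
  have 2: "sign (p \<circ> Transposition.transpose a b) = - sign p"
    using swap t by (subst sign_compose) (auto simp: sign_swap_id permutation_permutes)
  show ?case
    unfolding 1 2 using swap by simp
qed (simp add: sign_id)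

lemma oriented_chains_iff:
  "c \<in> oriented_chains K j \<longleftrightarrow> alternating (Poly_Mapping.lookup c) \<and>
     (\<forall>xs. Poly_Mapping.lookup c xs \<noteq> 0 \<longrightarrow> length xs = Suc j \<and> set xs \<in> K)"
  (is "?L \<longleftrightarrow> ?R")
proof
  assume c: ?L
  show ?R
    unfolding alternating_def
  proof (intro conjI allI)
    fix us vs :: "'a list" and a b
    have "Transposition.transpose (length us) (length us + Suc (length ([] :: 'a list))) permutes {..<length (us @ b # [] @ a # vs)}"
      by (rule permutes_swap_id) auto
    then have "Poly_Mapping.lookup c (permute_list (Transposition.transpose (length us) (length us + Suc (length ([] :: 'a list)))) (us @ b # [] @ a # vs))
        = - Poly_Mapping.lookup c (us @ b # [] @ a # vs)"
      using c unfolding oriented_chains_def by (auto simp: sign_swap_id)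
    then show "Poly_Mapping.lookup c (us @ a # b # vs) = - Poly_Mapping.lookup c (us @ b # a # vs)"
      unfolding permute_list_transpose by simp
    show "Poly_Mapping.lookup c (us @ a # a # vs) = 0"
      using c unfolding oriented_chains_def by (force simp: in_keys_iff)
  qed (use c in \<open>auto simp: oriented_chains_def in_keys_iff\<close>)
next
  assume ?R
  then show ?L
    unfolding oriented_chains_def
    using alternating_permute[of "Poly_Mapping.lookup c"] alternating_distinct[of "Poly_Mapping.lookup c"]
    by (auto simp: in_keys_iff)
qed

lemma oriented_chains_linear_subspace: "linear_subspace (oriented_chains K j)"
proof -
  have nz: "a \<noteq> 0 \<or> b \<noteq> 0" if "a + b \<noteq> (0 :: 'b)" for a b
    using that by auto
  show ?thesis
    unfolding linear_subspace_def
  proof (intro conjI ballI allI)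
    fix x y :: "('a, 'b) chain" and r
    assume x: "x \<in> oriented_chains K j"
    note x' = x[unfolded oriented_chains_iff]
    show "scale r x \<in> oriented_chains K j"
      unfolding oriented_chains_iff
    proof (intro conjI allI impI)
      show "alternating (Poly_Mapping.lookup (scale r x))"
        unfolding alternating_def lookup_scale
        using alternatingD(1,2)[OF conjunct1[OF x']] by (metis mult_minus_right mult_zero_right)
    qed (use x' in auto)
    assume y: "y \<in> oriented_chains K j"
    note y' = y[unfolded oriented_chains_iff]
    show "x + y \<in> oriented_chains K j"
      unfolding oriented_chains_iff
    proof (intro conjI allI impI)
      show "alternating (Poly_Mapping.lookup (x + y))"
        unfolding alternating_def lookup_add
        using alternatingD(1,2)[OF conjunct1[OF x']] alternatingD(1,2)[OF conjunct1[OF y']]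
        by (metis add.right_neutral minus_add_distrib)
    qed (use x' y' in \<open>auto simp: lookup_add dest!: nz\<close>)
  qed (simp add: oriented_chains_iff alternating_def)
qed

section \<open>The exterior product with a vertex\<close>

text \<open>On an alternating \<open>f\<close>, \<open>wedge q f\<close> is the join of the vertex \<open>q\<close> with the chain \<open>f\<close>: its value at
  \<open>[x\<^sub>0, \<dots>, x\<^sub>n]\<close> is the sum of \<open>(-1)\<^sup>i f [x\<^sub>0, \<dots>, x\<^sub>i\<^sub>-\<^sub>1, x\<^sub>i\<^sub>+\<^sub>1, \<dots>, x\<^sub>n]\<close> over the \<open>i\<close> with \<open>x\<^sub>i = q\<close>.\<close>

fun wedge :: "'a \<Rightarrow> ('a list \<Rightarrow> 'f::field) \<Rightarrow> 'a list \<Rightarrow> 'f" where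
  "wedge q f [] = 0"
| "wedge q f (x # xs) = (if x = q then f xs else 0) - wedge q (\<lambda>ys. f (x # ys)) xs"

lemma wedge_linear:
  "wedge q (\<lambda>_. 0) xs = 0"
  "wedge q (\<lambda>ys. - f ys) xs = - wedge q f xs"
  "wedge q (\<lambda>ys. f ys - g ys) xs = wedge q f xs - wedge q g xs"
  "wedge q (\<lambda>ys. \<Sum>y\<in>V. h y ys) xs = (\<Sum>y\<in>V. wedge q (h y) xs)"
  by (induction xs arbitrary: f g h) (auto simp: sum_subtractf)

lemma wedge_support:
  "wedge q f xs \<noteq> 0 \<Longrightarrow> \<exists>us vs. xs = us @ q # vs \<and> f (us @ vs) \<noteq> 0"
proof (induction xs arbitrary: f)
  case (Cons x xs)
  show ?case
  proof (cases "x = q \<and> f xs \<noteq> 0")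
    case True
    then show ?thesis by (intro exI[of _ "[]"] exI[of _ xs]) simp
  next
    case False
    then have "wedge q (\<lambda>ys. f (x # ys)) xs \<noteq> 0"
      using Cons.prems by (auto split: if_splits)
    then obtain us vs where "xs = us @ q # vs" "f (x # us @ vs) \<noteq> 0"
      using Cons.IH by blast
    then show ?thesis by (intro exI[of _ "x # us"] exI[of _ vs]) simp
  qed
qed simp

lemma alternating_wedge:
  assumes "alternating f"
  shows "alternating (wedge q f)"
proof -
  have "wedge q f (us @ a # b # vs) = - wedge q f (us @ b # a # vs)" if "alternating f" for us a b vs f
    using that
  proof (induction us arbitrary: f)
    case Nil
    then have "(\<lambda>ys. f (a # b # ys)) = (\<lambda>ys. - f (b # a # ys))"
      by (intro ext alternatingD(3))
    then show ?case by (simp add: wedge_linear)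
  next
    case (Cons u us)
    show ?case
      using Cons.IH[OF alternating_Cons[OF Cons.prems], of u] alternatingD(1)[OF Cons.prems, of us a b vs]
      by simp
  qed
  moreover have "wedge q f (us @ a # a # vs) = 0" if "alternating f" for us a vs f
    using that
  proof (induction us arbitrary: f)
    case Nil
    then have "(\<lambda>ys. f (a # a # ys)) = (\<lambda>ys. 0)"
      by (intro ext alternatingD(4))
    then show ?case by (simp add: wedge_linear)
  next
    case (Cons u us)
    show ?case
      using Cons.IH[OF alternating_Cons[OF Cons.prems]] alternatingD(2)[OF Cons.prems] by simp
  qed
  ultimately show ?thesis
    using assms unfolding alternating_def by blast
qed

lemma wedge_contraction:
  "alternating f \<Longrightarrow> p \<in> set xs \<Longrightarrow> wedge p (\<lambda>ys. f (p # ys)) xs = f xs"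
proof (induction xs arbitrary: f)
  case (Cons x xs)
  show ?case
  proof (cases "x = p")
    case True
    then have "(\<lambda>ys. f (p # x # ys)) = (\<lambda>ys. 0)"
      using True by (intro ext) (simp add: alternatingD(4)[OF Cons.prems(1)])
    then show ?thesis
      using True by (simp add: wedge_linear)
  next
    case False
    have "(\<lambda>ys. f (p # x # ys)) = (\<lambda>ys. - f (x # p # ys))"
      by (intro ext alternatingD(3)[OF Cons.prems(1)])
    then show ?thesis
      using False Cons.IH[OF alternating_Cons[OF Cons.prems(1)]] Cons.prems(2) by (simp add: wedge_linear)
  qed
qed simp

text \<open>The boundary of a chain whose vertices lie in the finite set \<open>V\<close>.\<close>

definition face_sum :: "'a set \<Rightarrow> ('a list \<Rightarrow> 'f::field) \<Rightarrow> 'a list \<Rightarrow> 'f" where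
  "face_sum V f xs = (\<Sum>y\<in>V. f (y # xs))"

lemma face_sum_wedge:
  assumes "finite V" "q \<in> V"
  shows "face_sum V (wedge q f) xs = f xs - wedge q (face_sum V f) xs"
proof -
  have "face_sum V f = (\<lambda>ys. \<Sum>y\<in>V. f (y # ys))"
    by (simp add: face_sum_def fun_eq_iff)
  then show ?thesis
    using assms by (simp add: face_sum_def[of V "wedge q f"] sum_subtractf wedge_linear(4))
qed

lemma lookup_boundary:
  assumes V: "finite V" and c: "\<And>xs. Poly_Mapping.lookup c xs \<noteq> 0 \<Longrightarrow> xs \<noteq> [] \<and> set xs \<subseteq> V"
  shows "Poly_Mapping.lookup (boundary c) ys = face_sum V (Poly_Mapping.lookup c) ys"
proof -
  let ?S = "{xs \<in> Poly_Mapping.keys c. tl xs = ys}"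
  have "Poly_Mapping.lookup (boundary c) ys = (\<Sum>xs\<in>Poly_Mapping.keys c. if tl xs = ys then Poly_Mapping.lookup c xs else 0)"
    unfolding boundary_def lookup_sum by (intro sum.cong) (auto simp: lookup_single when_def)
  also have "\<dots> = sum (Poly_Mapping.lookup c) ?S"
    by (simp add: sum.inter_filter)
  also have "\<dots> = sum (Poly_Mapping.lookup c) ((\<lambda>y. y # ys) ` V)"
  proof (rule sum.mono_neutral_left)
    show "?S \<subseteq> (\<lambda>y. y # ys) ` V"
    proof
      fix xs assume "xs \<in> ?S"
      then have "xs \<noteq> []" "set xs \<subseteq> V" "tl xs = ys"
        using c by (auto simp: in_keys_iff)
      then show "xs \<in> (\<lambda>y. y # ys) ` V"
        by (cases xs) auto
    qed
  qed (use V in \<open>auto simp: in_keys_iff\<close>)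
  also have "\<dots> = face_sum V (Poly_Mapping.lookup c) ys"
    unfolding face_sum_def by (subst sum.reindex) (auto simp: inj_on_def)
  finally show ?thesis .
qed

lemma lookup_Abs_chain:
  assumes "finite V" "\<And>xs. f xs \<noteq> 0 \<Longrightarrow> length xs = n \<and> set xs \<subseteq> V"
  shows "Poly_Mapping.lookup (Abs_poly_mapping f) = f"
proof (rule lookup_Abs_poly_mapping)
  have "{xs. f xs \<noteq> 0} \<subseteq> {xs. set xs \<subseteq> V \<and> length xs = n}"
    using assms by auto
  then show "finite {xs. f xs \<noteq> 0}"
    by (rule finite_subset) (rule finite_lists_length_eq[OF assms(1)])
qed

definition vertices :: "('a, 'f::field) chain \<Rightarrow> 'a set" where
  "vertices c = (\<Union>xs\<in>Poly_Mapping.keys c. set xs)"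

lemma finite_vertices [simp]: "finite (vertices c)"
  by (simp add: vertices_def)

lemma vertices_iff: "x \<in> vertices c \<longleftrightarrow> (\<exists>xs. Poly_Mapping.lookup c xs \<noteq> 0 \<and> x \<in> set xs)"
  by (auto simp: vertices_def in_keys_iff)

lemma vertices_subset: "Poly_Mapping.lookup c xs \<noteq> 0 \<Longrightarrow> set xs \<subseteq> vertices c"
  by (auto simp: vertices_iff)

lemma lookup_boundary_oriented:
  assumes "c \<in> oriented_chains K j" "finite V" "vertices c \<subseteq> V"
  shows "Poly_Mapping.lookup (boundary c) = face_sum V (Poly_Mapping.lookup c)"
proof
  fix ys
  have "xs \<noteq> [] \<and> set xs \<subseteq> V" if "Poly_Mapping.lookup c xs \<noteq> 0" for xs
    using assms that vertices_subset[of c xs] by (auto simp: oriented_chains_iff)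
  then show "Poly_Mapping.lookup (boundary c) ys = face_sum V (Poly_Mapping.lookup c) ys"
    using assms by (intro lookup_boundary)
qed

lemma boundary_zero [simp]: "boundary 0 = 0"
  by (simp add: boundary_def)

lemma boundary_linear:
  assumes "c \<in> oriented_chains K j" "c' \<in> oriented_chains K j"
  shows "boundary (c + c') = boundary c + boundary c'" "boundary (scale r c) = scale r (boundary c)"
    "boundary (c - c') = boundary c - boundary c'"
proof -
  let ?V = "vertices c \<union> vertices c'"
  note sub = oriented_chains_linear_subspace[of K j]
  have b: "Poly_Mapping.lookup (boundary d) = face_sum ?V (Poly_Mapping.lookup d)"
    if "d = c + c' \<or> d = scale r c \<or> d = c - c' \<or> d = c \<or> d = c'" for d
  proof (rule lookup_boundary_oriented)
    show "d \<in> oriented_chains K j"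
      using that linear_subspaceD[OF sub] assms by auto
    have "Poly_Mapping.lookup d xs = 0" if "Poly_Mapping.lookup c xs = 0" "Poly_Mapping.lookup c' xs = 0" for xs
      using that \<open>d = c + c' \<or> d = scale r c \<or> d = c - c' \<or> d = c \<or> d = c'\<close>
      by (auto simp: lookup_add lookup_minus)
    then show "vertices d \<subseteq> ?V"
      unfolding vertices_iff subset_iff Un_iff by blast
  qed simp
  show "boundary (c + c') = boundary c + boundary c'"
    by (rule poly_mapping_eqI) (simp add: b lookup_add face_sum_def sum.distrib)
  show "boundary (c - c') = boundary c - boundary c'"
    by (rule poly_mapping_eqI) (simp add: b lookup_minus face_sum_def sum_subtractf)
  show "boundary (scale r c) = scale r (boundary c)"
    by (rule poly_mapping_eqI) (simp add: b face_sum_def sum_distrib_left)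
qed

lemma cycles_linear_subspace: "linear_subspace (cycles K j :: ('a, 'f::field) chain set)"
proof -
  note o = linear_subspaceD[OF oriented_chains_linear_subspace[of K j, where 'b = 'f]]
  show ?thesis
    unfolding linear_subspace_def cycles_def
    using o(1) by (auto simp: boundary_linear(1,2)[where K = K and j = j] scale_algebra o(2,3))
qed

lemma boundaries_linear_subspace: "linear_subspace (boundaries K j :: ('a, 'f::field) chain set)"
proof -
  note o = linear_subspaceD[OF oriented_chains_linear_subspace[of K "Suc j", where 'b = 'f]]
  show ?thesis
    unfolding linear_subspace_def boundaries_def
  proof (intro conjI ballI allI)
    show "(0 :: ('a, 'f) chain) \<in> boundary ` oriented_chains K (Suc j)"
      by (rule image_eqI[of _ _ 0]) (simp_all add: o(1))
  next
    fix x y :: "('a, 'f) chain" and r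
    assume "x \<in> boundary ` oriented_chains K (Suc j)"
    then obtain c where c: "c \<in> oriented_chains K (Suc j)" "x = boundary c" by blast
    show "scale r x \<in> boundary ` oriented_chains K (Suc j)"
      by (rule image_eqI[OF _ o(3)[OF c(1)]]) (simp add: boundary_linear(2)[OF c(1) c(1)] c(2))
    assume "y \<in> boundary ` oriented_chains K (Suc j)"
    then obtain d where d: "d \<in> oriented_chains K (Suc j)" "y = boundary d" by blast
    show "x + y \<in> boundary ` oriented_chains K (Suc j)"
      by (rule image_eqI[OF _ o(2)[OF c(1) d(1)]]) (simp add: boundary_linear(1)[OF c(1) d(1)] c(2) d(2))
  qed
qed

section \<open>Moving a vertex of a chain\<close>

text \<open>Let \<open>a\<close> be the link of \<open>p\<close> in \<open>c\<close>, so that \<open>c = p \<and> a +\<close> (terms without \<open>p\<close>). Since \<open>p\<close> does not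
  occur in the boundary of \<open>c\<close>, \<open>a\<close> is a cycle; hence \<open>c' = c - p \<and> a + q \<and> a\<close> has the boundary of \<open>c\<close>, and
  \<open>c - c'\<close> is the boundary of \<open>q \<and> p \<and> a\<close>.\<close>

lemma move_vertex:
  fixes c :: "('a, 'f::field) chain"
  assumes c: "c \<in> oriented_chains K n" and pq: "p \<noteq> q" and dp: "p \<notin> vertices (boundary c)"
    and K: "\<And>\<sigma>. \<sigma> \<in> K \<Longrightarrow> \<sigma> \<subseteq> vertices c \<Longrightarrow> p \<in> \<sigma> \<Longrightarrow> insert q (\<sigma> - {p}) \<in> K"
    and K': "\<And>\<sigma>. \<sigma> \<in> K \<Longrightarrow> \<sigma> \<subseteq> vertices c \<Longrightarrow> p \<in> \<sigma> \<Longrightarrow> insert q \<sigma> \<in> K'"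
  obtains c' where "c' \<in> oriented_chains K n" "boundary c' = boundary c"
    "vertices c' \<subseteq> insert q (vertices c - {p})" "c - c' \<in> boundaries K' n"
proof -
  define f where "f = Poly_Mapping.lookup c"
  define a where "a = (\<lambda>ys. f (p # ys))"
  define V where "V = insert p (insert q (vertices c))"
  define g where "g = (\<lambda>xs. f xs - wedge p a xs + wedge q a xs)"
  define h where "h = wedge q (wedge p a)"
  have V: "finite V" "p \<in> V" "q \<in> V" "vertices c \<subseteq> V"
    by (auto simp: V_def)
  have alt_f: "alternating f"
    using c by (simp add: f_def oriented_chains_iff)
  have alt_a: "alternating a"
    unfolding a_def by (rule alternating_Cons[OF alt_f])
  have alt_h: "alternating h"
    unfolding h_def by (intro alternating_wedge alt_a)
  have alt_g: "alternating g"
  proof -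
    note w = alternatingD(1,2)[OF alternating_wedge[OF alt_a]]
    show ?thesis
      unfolding alternating_def g_def
    proof (intro conjI allI)
      show "f (us @ x # y # vs) - wedge p a (us @ x # y # vs) + wedge q a (us @ x # y # vs)
        = - (f (us @ y # x # vs) - wedge p a (us @ y # x # vs) + wedge q a (us @ y # x # vs))" for us x y vs
        using alternatingD(1)[OF alt_f, of us x y vs] w(1)[of p us x y vs] w(1)[of q us x y vs] by simp
    qed (simp add: w(2) alternatingD(2)[OF alt_f])
  qed
  have supp_f: "length xs = Suc n \<and> set xs \<in> K \<and> set xs \<subseteq> vertices c \<and> distinct xs" if "f xs \<noteq> 0" for xs
    using that c alternating_distinct[OF alt_f] vertices_subset[of c] by (auto simp: f_def oriented_chains_iff)
  have wedge_a: "\<exists>us vs. xs = us @ r # vs \<and> f (p # us @ vs) \<noteq> 0" if "wedge r a xs \<noteq> 0" for r xs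
    using wedge_support[OF that] by (simp add: a_def)
  have g_eq: "g xs = (if p \<in> set xs then 0 else f xs) + wedge q a xs" for xs
  proof (cases "p \<in> set xs")
    case True
    then show ?thesis
      using wedge_contraction[OF alt_f True] by (simp add: g_def a_def)
  next
    case False
    then have "wedge p a xs = 0"
      using wedge_a[of p xs] by (metis in_set_conv_decomp)
    then show ?thesis
      using False by (simp add: g_def)
  qed
  have supp_g: "length xs = Suc n \<and> set xs \<in> K \<and> set xs \<subseteq> insert q (vertices c - {p})" if nz: "g xs \<noteq> 0" for xs
  proof -
    have "p \<notin> set xs \<and> f xs \<noteq> 0 \<or> wedge q a xs \<noteq> 0"
      using nz unfolding g_eq by (auto split: if_splits)
    then consider "p \<notin> set xs" "f xs \<noteq> 0" | "wedge q a xs \<noteq> 0"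
      by blast
    then show ?thesis
    proof cases
      case 1
      then show ?thesis using supp_f by auto
    next
      case 2
      then obtain us vs where xs: "xs = us @ q # vs" and nz: "f (p # us @ vs) \<noteq> 0"
        using wedge_a by blast
      have "insert q (set (p # us @ vs) - {p}) \<in> K"
        using supp_f[OF nz] by (intro K) auto
      moreover have "set xs = insert q (set (p # us @ vs) - {p})"
        using supp_f[OF nz] by (auto simp: xs)
      moreover have "length xs = Suc n" "set xs \<subseteq> insert q (vertices c - {p})"
        using supp_f[OF nz] by (auto simp: xs)
      ultimately show ?thesis
        by simp
    qed
  qed
  have supp_h: "length xs = Suc (Suc n) \<and> set xs \<in> K' \<and> set xs \<subseteq> V" if nz: "h xs \<noteq> 0" for xs
  proof -
    from wedge_support[OF nz[unfolded h_def]] obtain us vs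
      where xs1: "xs = us @ q # vs" and nz1: "wedge p a (us @ vs) \<noteq> 0" by blast
    from wedge_a[OF nz1] obtain us' vs'
      where xs2: "us @ vs = us' @ p # vs'" and nz: "f (p # us' @ vs') \<noteq> 0" by blast
    note xs = xs1 xs2
    have set: "set xs = insert q (set (p # us' @ vs'))"
      using arg_cong[OF xs(2), of set] by (auto simp: xs(1))
    have "length xs = Suc (Suc n)"
      using arg_cong[OF xs(2), of length] supp_f[OF nz] by (simp add: xs(1))
    moreover have "insert q (set (p # us' @ vs')) \<in> K'"
      using supp_f[OF nz] by (intro K') auto
    ultimately show ?thesis
      using set supp_f[OF nz] V by auto
  qed
  define c' where "c' = Abs_poly_mapping g"
  define d where "d = Abs_poly_mapping h"
  have c'_g: "Poly_Mapping.lookup c' = g"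
    unfolding c'_def using V(1) supp_g V by (intro lookup_Abs_chain[of V _ "Suc n"]) auto
  have d_h: "Poly_Mapping.lookup d = h"
    unfolding d_def using V(1) supp_h by (intro lookup_Abs_chain[of V _ "Suc (Suc n)"]) auto
  have c': "c' \<in> oriented_chains K n"
    using alt_g supp_g by (simp add: oriented_chains_iff c'_g)
  have d: "d \<in> oriented_chains K' (Suc n)"
    using alt_h supp_h by (simp add: oriented_chains_iff d_h)
  have vc': "vertices c' \<subseteq> insert q (vertices c - {p})"
    using supp_g by (fastforce simp: vertices_iff c'_g)
  have vd: "vertices d \<subseteq> V"
    using supp_h by (fastforce simp: vertices_iff d_h)
  have bc: "Poly_Mapping.lookup (boundary c) = face_sum V f"
    using lookup_boundary_oriented[OF c V(1,4)] by (simp add: f_def)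
  have "face_sum V a ys = 0" for ys
  proof -
    have "face_sum V a ys = - face_sum V f (p # ys)"
      unfolding face_sum_def a_def sum_negf[symmetric]
      by (intro sum.cong refl alternatingD(3)[OF alt_f])
    also have "face_sum V f (p # ys) = 0"
      using dp unfolding vertices_iff bc by auto
    finally show ?thesis by simp
  qed
  then have face_a: "face_sum V a = (\<lambda>ys. 0)"
    by blast
  have face_wedge_a: "face_sum V (wedge r a) = a" if "r \<in> V" for r
    using face_sum_wedge[OF V(1) that, of a] by (simp add: fun_eq_iff face_a wedge_linear)
  have "face_sum V g xs = face_sum V f xs" for xs
    using face_wedge_a[OF V(2)] face_wedge_a[OF V(3)]
    by (simp add: g_def face_sum_def sum.distrib sum_subtractf fun_eq_iff)
  moreover have "vertices c' \<subseteq> V"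
    using vc' V by auto
  ultimately have bc': "boundary c' = boundary c"
    using lookup_boundary_oriented[OF c' V(1)] bc by (intro poly_mapping_eqI) (simp add: c'_g)
  have "c - c' = boundary d"
  proof (rule poly_mapping_eqI)
    fix xs
    have "Poly_Mapping.lookup (boundary d) xs = wedge p a xs - wedge q a xs"
      using lookup_boundary_oriented[OF d V(1) vd] face_sum_wedge[OF V(1,3), of "wedge p a" xs]
        face_wedge_a[OF V(2)] by (simp add: d_h h_def)
    then show "Poly_Mapping.lookup (c - c') xs = Poly_Mapping.lookup (boundary d) xs"
      by (simp add: lookup_minus c'_g g_def f_def)
  qed
  then have "c - c' \<in> boundaries K' n"
    using d by (simp add: boundaries_def)
  then show ?thesis
    using that c' bc' vc' by blast
qed

text \<open>The weights \<open>\<mu>\<close> only serve to show that finitely many moves suffice.\<close>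

lemma move_vertices_into:
  fixes c :: "('a, 'f::field) chain" and \<mu> :: "'a \<Rightarrow> nat"
  assumes c: "c \<in> oriented_chains K n" and bc: "vertices (boundary c) \<subseteq> A"
    and step: "\<And>V. finite V \<Longrightarrow> V \<subseteq> \<Union>K \<Longrightarrow> \<not> V \<subseteq> A \<Longrightarrow> \<exists>p\<in>V - A. \<exists>q. \<mu> q < \<mu> p \<and>
        (\<forall>\<sigma>\<in>K. \<sigma> \<subseteq> V \<longrightarrow> p \<in> \<sigma> \<longrightarrow> insert q (\<sigma> - {p}) \<in> K \<and> insert q \<sigma> \<in> K')"
  shows "\<exists>c'\<in>oriented_chains K n. boundary c' = boundary c \<and> vertices c' \<subseteq> A \<and> c - c' \<in> boundaries K' n"
  using c bc
proof (induction "sum \<mu> (vertices c)" arbitrary: c rule: less_induct)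
  case less
  note B = linear_subspaceD[OF boundaries_linear_subspace[of K' n, where 'f = 'f]]
  show ?case
  proof (cases "vertices c \<subseteq> A")
    case True
    then show ?thesis
      using less.prems B(1) by (intro bexI[of _ c]) auto
  next
    case False
    have "vertices c \<subseteq> \<Union>K"
      using less.prems(1) by (fastforce simp: vertices_iff oriented_chains_iff)
    from step[OF finite_vertices this False] obtain p where "p \<in> vertices c - A"
      and "\<exists>q. \<mu> q < \<mu> p \<and> (\<forall>\<sigma>\<in>K. \<sigma> \<subseteq> vertices c \<longrightarrow> p \<in> \<sigma> \<longrightarrow>
        insert q (\<sigma> - {p}) \<in> K \<and> insert q \<sigma> \<in> K')"
      by (rule bexE)
    then obtain q where p: "p \<in> vertices c" "p \<notin> A" and \<mu>: "\<mu> q < \<mu> p"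
      and K: "\<And>\<sigma>. \<sigma> \<in> K \<Longrightarrow> \<sigma> \<subseteq> vertices c \<Longrightarrow> p \<in> \<sigma> \<Longrightarrow> insert q (\<sigma> - {p}) \<in> K \<and> insert q \<sigma> \<in> K'"
      by auto
    have "p \<noteq> q" "p \<notin> vertices (boundary c)"
      using \<mu> p less.prems(2) by auto
    from move_vertex[OF less.prems(1) this K[THEN conjunct1] K[THEN conjunct2]]
    obtain c1 where c1: "c1 \<in> oriented_chains K n" "boundary c1 = boundary c"
      "vertices c1 \<subseteq> insert q (vertices c - {p})" "c - c1 \<in> boundaries K' n"
      by blast
    have "sum \<mu> (vertices c1) \<le> sum \<mu> (insert q (vertices c - {p}))"
      using c1(3) by (intro sum_mono2) auto
    also have "\<dots> \<le> \<mu> q + sum \<mu> (vertices c - {p})"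
      by (simp add: sum.insert_if)
    also have "\<dots> < sum \<mu> (vertices c)"
      using \<mu> p by (simp add: sum.remove[of "vertices c" p \<mu>])
    finally obtain c' where c': "c' \<in> oriented_chains K n" "boundary c' = boundary c1"
      "vertices c' \<subseteq> A" "c1 - c' \<in> boundaries K' n"
      using less.hyps[OF _ c1(1)] less.prems(2) c1(2) by auto
    moreover have "c - c' \<in> boundaries K' n"
      using B(2)[OF c1(4) c'(4)] by simp
    ultimately show ?thesis
      using c1(2) by auto
  qed
qed

section \<open>Chains and injective maps\<close>

definition push_chain :: "('a \<Rightarrow> 'b) \<Rightarrow> ('a, 'f::field) chain \<Rightarrow> ('b, 'f) chain" where
  "push_chain f c = Abs_poly_mapping
     (\<lambda>ys. if set ys \<subseteq> range f then Poly_Mapping.lookup c (map (inv_into UNIV f) ys) else 0)"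

lemma map_map_inv: "set ys \<subseteq> range f \<Longrightarrow> map f (map (inv_into UNIV f) ys) = ys"
  by (induction ys) (auto simp: f_inv_into_f)

lemma lookup_push_chain:
  "Poly_Mapping.lookup (push_chain f c) ys
     = (if set ys \<subseteq> range f then Poly_Mapping.lookup c (map (inv_into UNIV f) ys) else 0)"
proof -
  have "{ys. (if set ys \<subseteq> range f then Poly_Mapping.lookup c (map (inv_into UNIV f) ys) else 0) \<noteq> 0}
      \<subseteq> map f ` Poly_Mapping.keys c"
  proof
    fix ys
    assume "ys \<in> {ys. (if set ys \<subseteq> range f then Poly_Mapping.lookup c (map (inv_into UNIV f) ys) else 0) \<noteq> 0}"
    then have "set ys \<subseteq> range f" "map (inv_into UNIV f) ys \<in> Poly_Mapping.keys c"
      by (auto simp: in_keys_iff split: if_splits)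
    then show "ys \<in> map f ` Poly_Mapping.keys c"
      using map_map_inv by (metis imageI)
  qed
  then have "finite {ys. (if set ys \<subseteq> range f then Poly_Mapping.lookup c (map (inv_into UNIV f) ys) else 0) \<noteq> 0}"
    by (rule finite_subset) simp
  then show ?thesis
    unfolding push_chain_def by (subst lookup_Abs_poly_mapping) simp_all
qed

lemma push_chain_linear:
  "push_chain f (c + c') = push_chain f c + push_chain f c'"
  "push_chain f (scale r c) = scale r (push_chain f c)"
  by (rule poly_mapping_eqI; simp add: lookup_push_chain lookup_add)+

lemma lookup_push_chain_map:
  "inj f \<Longrightarrow> Poly_Mapping.lookup (push_chain f c) (map f xs) = Poly_Mapping.lookup c xs"
  by (auto simp: lookup_push_chain comp_def)

lemma push_chain_inject: "inj f \<Longrightarrow> push_chain f c = push_chain f c' \<longleftrightarrow> c = c'"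
  by (metis lookup_push_chain_map poly_mapping_eqI)

lemma push_chain_support:
  assumes "Poly_Mapping.lookup (push_chain f c) ys \<noteq> 0"
  obtains xs where "ys = map f xs" "Poly_Mapping.lookup c xs \<noteq> 0"
  using assms map_map_inv[of ys f] by (metis lookup_push_chain)

lemma push_chain_oriented:
  assumes c: "c \<in> oriented_chains K n" and K: "\<And>\<sigma>. \<sigma> \<in> K \<Longrightarrow> f ` \<sigma> \<in> K'"
  shows "push_chain f c \<in> oriented_chains K' n"
  unfolding oriented_chains_iff
proof (intro conjI allI impI)
  note c' = c[unfolded oriented_chains_iff]
  show "alternating (Poly_Mapping.lookup (push_chain f c))"
    unfolding alternating_def
  proof (intro conjI allI)
    fix us x y vs
    show "Poly_Mapping.lookup (push_chain f c) (us @ x # y # vs) = - Poly_Mapping.lookup (push_chain f c) (us @ y # x # vs)"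
      using alternatingD(1)[OF conjunct1[OF c'], of "map (inv_into UNIV f) us" "inv_into UNIV f x" "inv_into UNIV f y" "map (inv_into UNIV f) vs"]
      by (simp add: lookup_push_chain)
  qed (simp add: lookup_push_chain alternatingD(2)[OF conjunct1[OF c']])
  fix ys
  assume "Poly_Mapping.lookup (push_chain f c) ys \<noteq> 0"
  then obtain xs where "ys = map f xs" "Poly_Mapping.lookup c xs \<noteq> 0"
    by (rule push_chain_support)
  then show "length ys = Suc n" "set ys \<in> K'"
    using c' K by auto
qed

lemma vertices_push_chain: "vertices (push_chain f c) \<subseteq> f ` vertices c"
proof
  fix y
  assume "y \<in> vertices (push_chain f c)"
  then obtain ys where ys: "Poly_Mapping.lookup (push_chain f c) ys \<noteq> 0" "y \<in> set ys"
    unfolding vertices_iff by blast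
  from ys(1) obtain xs where "ys = map f xs" "Poly_Mapping.lookup c xs \<noteq> 0"
    by (rule push_chain_support)
  then show "y \<in> f ` vertices c"
    using ys(2) vertices_subset[of c xs] by auto
qed

lemma boundary_push_chain:
  assumes f: "inj f" and c: "c \<in> oriented_chains K n"
  shows "boundary (push_chain f c) = push_chain f (boundary c)"
proof (rule poly_mapping_eqI)
  fix ys
  have "push_chain f c \<in> oriented_chains ((\<lambda>\<sigma>. f ` \<sigma>) ` K) n"
    by (rule push_chain_oriented[OF c]) simp
  then have "Poly_Mapping.lookup (boundary (push_chain f c)) ys
      = face_sum (f ` vertices c) (Poly_Mapping.lookup (push_chain f c)) ys"
    using lookup_boundary_oriented vertices_push_chain by (metis finite_imageI finite_vertices)
  also have "\<dots> = (\<Sum>x\<in>vertices c. Poly_Mapping.lookup (push_chain f c) (f x # ys))"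
    unfolding face_sum_def by (subst sum.reindex) (auto intro: inj_on_subset[OF f])
  also have "\<dots> = (if set ys \<subseteq> range f then face_sum (vertices c) (Poly_Mapping.lookup c) (map (inv_into UNIV f) ys) else 0)"
    using f by (simp add: lookup_push_chain face_sum_def)
  also have "\<dots> = Poly_Mapping.lookup (push_chain f (boundary c)) ys"
    by (simp add: lookup_push_chain lookup_boundary_oriented[OF c finite_vertices order_refl])
  finally show "Poly_Mapping.lookup (boundary (push_chain f c)) ys = Poly_Mapping.lookup (push_chain f (boundary c)) ys" .
qed

lemma push_chain_surj:
  assumes f: "inj f" and c': "c' \<in> oriented_chains K' n" and v: "vertices c' \<subseteq> range f"
    and K: "\<And>\<sigma>. f ` \<sigma> \<in> K' \<Longrightarrow> \<sigma> \<in> K"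
  obtains c where "c \<in> oriented_chains K n" "push_chain f c = c'"
proof -
  define c where "c = Abs_poly_mapping (\<lambda>xs. Poly_Mapping.lookup c' (map f xs))"
  have "finite {xs. Poly_Mapping.lookup c' (map f xs) \<noteq> 0}"
  proof -
    have "finite (map f -` Poly_Mapping.keys c')"
      using f by (intro finite_vimageI) auto
    then show ?thesis by (simp add: vimage_def in_keys_iff)
  qed
  then have l: "Poly_Mapping.lookup c xs = Poly_Mapping.lookup c' (map f xs)" for xs
    unfolding c_def by simp
  note c'' = c'[unfolded oriented_chains_iff]
  have "c \<in> oriented_chains K n"
    unfolding oriented_chains_iff
  proof (intro conjI allI impI)
    show "alternating (Poly_Mapping.lookup c)"
      unfolding alternating_def l map_append list.map
      by (intro conjI allI alternatingD(1,2)[OF conjunct1[OF c'']])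
    fix xs assume "Poly_Mapping.lookup c xs \<noteq> 0"
    then show "length xs = Suc n" "set xs \<in> K"
      using c'' K[of "set xs"] by (auto simp: l)
  qed
  moreover have "push_chain f c = c'"
  proof (rule poly_mapping_eqI)
    fix ys
    have "set ys \<subseteq> range f" if "Poly_Mapping.lookup c' ys \<noteq> 0"
      using v vertices_subset[OF that] by auto
    then show "Poly_Mapping.lookup (push_chain f c) ys = Poly_Mapping.lookup c' ys"
      by (auto simp: lookup_push_chain l map_map_inv simp del: map_map)
  qed
  ultimately show ?thesis by (rule that)
qed

lemma quotient_dim_push:
  fixes f :: "'a \<Rightarrow> 'b"
  assumes f: "inj f"
    and Ks: "\<And>\<sigma>. f ` \<sigma> \<in> Ks' \<longleftrightarrow> \<sigma> \<in> Ks" and Kt: "\<And>\<sigma>. f ` \<sigma> \<in> Kt' \<longleftrightarrow> \<sigma> \<in> Kt"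
    and surj: "\<And>z :: ('b, 'f::field) chain. z \<in> cycles Ks' j \<Longrightarrow>
        \<exists>z'\<in>cycles Ks' j. vertices z' \<subseteq> range f \<and> z - z' \<in> boundaries Kt' j"
    and inj: "\<And>w :: ('b, 'f) chain. w \<in> oriented_chains Kt' (Suc j) \<Longrightarrow> vertices (boundary w) \<subseteq> range f \<Longrightarrow>
        \<exists>w'\<in>oriented_chains Kt' (Suc j). boundary w' = boundary w \<and> vertices w' \<subseteq> range f"
  shows "quotient_dim (cycles Ks j :: ('a, 'f) chain set) (boundaries Kt j)
    = quotient_dim (cycles Ks' j :: ('b, 'f) chain set) (boundaries Kt' j)"
proof (rule quotient_dim_eq[where \<Phi> = "push_chain f"])
  have 0: "push_chain f 0 = (0 :: ('b, 'f) chain)"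
    by (rule poly_mapping_eqI) (simp add: lookup_push_chain)
  show "push_chain f ` cycles Ks j \<subseteq> (cycles Ks' j :: ('b, 'f) chain set)"
  proof
    fix c' assume "c' \<in> push_chain f ` (cycles Ks j :: ('a, 'f) chain set)"
    then obtain c where c: "c' = push_chain f c" "c \<in> oriented_chains Ks j" "boundary c = 0"
      by (auto simp: cycles_def)
    show "c' \<in> cycles Ks' j"
      unfolding cycles_def c(1) using push_chain_oriented[OF c(2) Ks[THEN iffD2]]
      by (simp add: boundary_push_chain[OF f c(2)] c(3) 0)
  qed
  show "push_chain f ` boundaries Kt j \<subseteq> (boundaries Kt' j :: ('b, 'f) chain set)"
  proof
    fix c' assume "c' \<in> push_chain f ` (boundaries Kt j :: ('a, 'f) chain set)"
    then obtain c where c: "c' = push_chain f (boundary c)" "c \<in> oriented_chains Kt (Suc j)"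
      by (auto simp: boundaries_def)
    show "c' \<in> boundaries Kt' j"
      unfolding boundaries_def c(1) boundary_push_chain[OF f c(2), symmetric]
      by (intro imageI push_chain_oriented[OF c(2) Kt[THEN iffD2]])
  qed
  show "z \<in> boundaries Kt j"
    if z: "z \<in> cycles Ks j" and p: "push_chain f z \<in> boundaries Kt' j" for z :: "('a, 'f) chain"
  proof -
    obtain w where w: "w \<in> oriented_chains Kt' (Suc j)" "push_chain f z = boundary w"
      using p by (auto simp: boundaries_def)
    have "vertices (boundary w) \<subseteq> range f"
      using vertices_push_chain[of f z] unfolding w(2) by blast
    from inj[OF w(1) this] obtain w' where w': "w' \<in> oriented_chains Kt' (Suc j)"
      "boundary w' = boundary w" "vertices w' \<subseteq> range f" by blast
    from push_chain_surj[OF f w'(1,3) Kt[THEN iffD1]]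
    obtain v where v: "v \<in> oriented_chains Kt (Suc j)" "push_chain f v = w'" .
    have "push_chain f (boundary v) = push_chain f z"
      using boundary_push_chain[OF f v(1)] v(2) w'(2) w(2) by simp
    then show ?thesis
      using v(1) by (auto simp: push_chain_inject[OF f] boundaries_def)
  qed
  show "\<exists>z\<in>cycles Ks j. z' - push_chain f z \<in> boundaries Kt' j"
    if z': "z' \<in> cycles Ks' j" for z' :: "('b, 'f) chain"
  proof -
    obtain z'' where z'': "z'' \<in> cycles Ks' j" "vertices z'' \<subseteq> range f" "z' - z'' \<in> boundaries Kt' j"
      using surj[OF z'] by blast
    have "z'' \<in> oriented_chains Ks' j" using z''(1) by (simp add: cycles_def)
    from push_chain_surj[OF f this z''(2) Ks[THEN iffD1]]
    obtain z where z: "z \<in> oriented_chains Ks j" "push_chain f z = z''" .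
    have "push_chain f (boundary z) = push_chain f 0"
      using boundary_push_chain[OF f z(1)] z(2) z''(1) 0 by (simp add: cycles_def)
    then have "z \<in> cycles Ks j"
      using z(1) by (simp add: push_chain_inject[OF f] cycles_def)
    then show ?thesis using z(2) z''(3) by blast
  qed
qed (simp_all add: cycles_linear_subspace boundaries_linear_subspace push_chain_linear)

section \<open>Ranks and diagrams\<close>

lemma vietoris_rips_mono: "s \<le> t \<Longrightarrow> vietoris_rips M d s \<subseteq> vietoris_rips M d t"
  unfolding vietoris_rips_def by (auto intro: order_trans)

lemma oriented_chains_mono: "K \<subseteq> K' \<Longrightarrow> oriented_chains K j \<subseteq> oriented_chains K' j"
  unfolding oriented_chains_def by blast

lemma boundaries_mono: "K \<subseteq> K' \<Longrightarrow> boundaries K j \<subseteq> boundaries K' j"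
  unfolding boundaries_def using oriented_chains_mono by blast

definition vr_rank ::
  "'f::field itself \<Rightarrow> nat \<Rightarrow> 'a set \<Rightarrow> ('a \<Rightarrow> 'a \<Rightarrow> real) \<Rightarrow> real \<Rightarrow> real \<Rightarrow> nat" where
  "vr_rank _ j M d s t = quotient_dim (cycles (vietoris_rips M d s) j :: ('a, 'f) chain set)
     (boundaries (vietoris_rips M d t) j)"

lemma persistence_rank_vietoris_rips:
  assumes "s \<le> t"
  shows "persistence_rank (\<lambda>r. reduced_homology (vietoris_rips M d r) j :: ('f::field, ('a, 'f) chain set) module)
      (\<lambda>s t. homology_inclusion (vietoris_rips M d t) j) s (ereal t) = vr_rank TYPE('f) j M d s t"
proof -
  let ?Bs = "boundaries (vietoris_rips M d s) j :: ('a, 'f) chain set"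
  let ?Bt = "boundaries (vietoris_rips M d t) j :: ('a, 'f) chain set"
  have "z +o ?Bs + ?Bt = z +o ?Bt" for z
    unfolding set_plus_rearrange3
    by (intro arg_cong[of _ _ "elt_set_plus z"] subspace_plus_subset boundaries_linear_subspace
        boundaries_mono vietoris_rips_mono assms)
  then have "homology_inclusion (vietoris_rips M d t) j ` carrier (reduced_homology (vietoris_rips M d s) j)
      = {z +o ?Bt | z. z \<in> cycles (vietoris_rips M d s) j}"
    by (auto simp: homology_inclusion_def reduced_homology_def image_iff)
  then show ?thesis
    by (simp add: persistence_rank_def vr_rank_def quotient_space_def reduced_homology_def)
qed

definition vr_rank_ext ::
  "'f::field itself \<Rightarrow> nat \<Rightarrow> 'a set \<Rightarrow> ('a \<Rightarrow> 'a \<Rightarrow> real) \<Rightarrow> real \<Rightarrow> ereal \<Rightarrow> int" where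
  "vr_rank_ext F j M d s t = (if t = \<infinity> then 0 else int (vr_rank F j M d s (real_of_ereal t)))"

definition vr_measure ::
  "'f::field itself \<Rightarrow> nat \<Rightarrow> 'a set \<Rightarrow> ('a \<Rightarrow> 'a \<Rightarrow> real) \<Rightarrow> real \<Rightarrow> real \<Rightarrow> real \<Rightarrow> ereal \<Rightarrow> int" where
  "vr_measure F j M d a b c e = vr_rank_ext F j M d b (ereal c) - vr_rank_ext F j M d a (ereal c)
     - vr_rank_ext F j M d b e + vr_rank_ext F j M d a e"

lemma rectangle_less:
  assumes "a < p \<and> p < b \<and> b < c \<and> ereal c < q \<and> (q < e \<or> e = \<infinity>)"
  shows "ereal a < ereal c" "ereal b < ereal c" "ereal a < e" "ereal b < e"
proof -
  have "a < c" "b < c" using assms by auto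
  moreover have "ereal c < e" using assms by (auto intro: less_trans)
  ultimately show "ereal a < ereal c" "ereal b < ereal c" "ereal a < e" "ereal b < e"
    by (auto intro: less_trans[of _ "ereal c"])
qed

lemma dgm_VR_apply:
  "dgm_VR TYPE('f::field) j M d (p, q) =
     (if ereal p < q
      then Inf {nat (vr_measure TYPE('f) j M d a b c e) | a b c e.
                  a < p \<and> p < b \<and> b < c \<and> ereal c < q \<and> (q < e \<or> e = \<infinity>)}
      else 0)"
proof -
  let ?V = "\<lambda>r. reduced_homology (vietoris_rips M d r) j :: ('f, ('a, 'f) chain set) module"
  let ?\<phi> = "\<lambda>(s::real) t. homology_inclusion (vietoris_rips M d t) j"
  have rank: "int (persistence_rank ?V ?\<phi> s t) = vr_rank_ext TYPE('f) j M d s t" if st: "ereal s < t" for s t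
  proof (cases t)
    case (real t')
    then show ?thesis
      using st by (simp add: persistence_rank_vietoris_rips vr_rank_ext_def)
  qed (use st in \<open>simp_all add: persistence_rank_def vr_rank_ext_def\<close>)
  have meas: "persistence_measure ?V ?\<phi> a b c e = vr_measure TYPE('f) j M d a b c e"
    if "a < p \<and> p < b \<and> b < c \<and> ereal c < q \<and> (q < e \<or> e = \<infinity>)" for a b c e
    using rectangle_less[OF that] by (simp add: persistence_measure_def vr_measure_def rank)
  have "{nat (persistence_measure ?V ?\<phi> a b c e) | a b c e. a < p \<and> p < b \<and> b < c \<and> ereal c < q \<and> (q < e \<or> e = \<infinity>)}
      = {nat (vr_measure TYPE('f) j M d a b c e) | a b c e. a < p \<and> p < b \<and> b < c \<and> ereal c < q \<and> (q < e \<or> e = \<infinity>)}"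
    by (intro Collect_cong ex_cong1, rule rev_conj_cong, rule refl) (subst meas, assumption, rule refl)
  then show ?thesis
    by (simp add: dgm_VR_def persistence_diagram_def)
qed

lemma dgm_VR_cong:
  assumes "\<And>s t. s < t \<Longrightarrow> vr_rank TYPE('f::field) j M d s t = vr_rank TYPE('f) j M' d' s t"
  shows "dgm_VR TYPE('f) j M d = dgm_VR TYPE('f) j M' d'"
proof -
  have ext: "vr_rank_ext TYPE('f) j M d s t = vr_rank_ext TYPE('f) j M' d' s t" if st: "ereal s < t" for s t
    using st assms by (cases t) (auto simp: vr_rank_ext_def)
  have meas: "vr_measure TYPE('f) j M d a b c e = vr_measure TYPE('f) j M' d' a b c e"
    if "a < p \<and> p < b \<and> b < c \<and> ereal c < q \<and> (q < e \<or> e = \<infinity>)" for a b c e p q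
    using rectangle_less[OF that] by (simp add: vr_measure_def ext)
  have "dgm_VR TYPE('f) j M d (p, q) = dgm_VR TYPE('f) j M' d' (p, q)" for p q
  proof -
    have "{nat (vr_measure TYPE('f) j M d a b c e) | a b c e. a < p \<and> p < b \<and> b < c \<and> ereal c < q \<and> (q < e \<or> e = \<infinity>)}
      = {nat (vr_measure TYPE('f) j M' d' a b c e) | a b c e. a < p \<and> p < b \<and> b < c \<and> ereal c < q \<and> (q < e \<or> e = \<infinity>)}"
      by (intro Collect_cong ex_cong1, rule rev_conj_cong, rule refl) (subst meas, assumption, rule refl)
    then show ?thesis
      unfolding dgm_VR_apply by simp
  qed
  then show ?thesis by (simp add: fun_eq_iff)
qed

lemma vertices_oriented_subset: "c \<in> oriented_chains K j \<Longrightarrow> vertices c \<subseteq> \<Union>K"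
  by (fastforce simp: vertices_iff oriented_chains_iff)

lemma dgm_VR_isometry:
  assumes f: "inj f" and d: "\<And>x y. x \<in> M \<Longrightarrow> y \<in> M \<Longrightarrow> d' (f x) (f y) = d x y"
  shows "dgm_VR TYPE('f::field) j M d = dgm_VR TYPE('f) j (f ` M) d'"
proof (rule dgm_VR_cong)
  fix s t :: real
  have vr: "f ` \<sigma> \<in> vietoris_rips (f ` M) d' r \<longleftrightarrow> \<sigma> \<in> vietoris_rips M d r" for \<sigma> r
    using d by (auto simp: vietoris_rips_def inj_image_subset_iff[OF f] inj_image_mem_iff[OF f]
        finite_image_iff[OF inj_on_subset[OF f]] subset_eq)
  have range: "vertices c \<subseteq> range f" if "c \<in> oriented_chains (vietoris_rips (f ` M) d' r) n"
    for c :: "('b, 'f) chain" and r n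
    using vertices_oriented_subset[OF that] unfolding vietoris_rips_def by fast
  show "vr_rank TYPE('f) j M d s t = vr_rank TYPE('f) j (f ` M) d' s t"
    unfolding vr_rank_def
  proof (rule quotient_dim_push[OF f vr vr])
    fix z :: "('b, 'f) chain"
    assume z: "z \<in> cycles (vietoris_rips (f ` M) d' s) j"
    then have "vertices z \<subseteq> range f"
      by (intro range[of _ s j]) (simp add: cycles_def)
    then show "\<exists>z'\<in>cycles (vietoris_rips (f ` M) d' s) j. vertices z' \<subseteq> range f \<and>
        z - z' \<in> boundaries (vietoris_rips (f ` M) d' t) j"
      using z linear_subspaceD(1)[OF boundaries_linear_subspace] by (intro bexI[of _ z]) auto
  qed (use range in blast)
qed

section \<open>Attaching edges\<close>

lemma oriented_chains_empty: "c \<in> oriented_chains {} n \<Longrightarrow> c = 0"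
  by (auto simp: oriented_chains_iff intro: poly_mapping_eqI)

lemma vertices_zero [simp]: "vertices 0 = {}"
  by (simp add: vertices_def)

definition glued_dist :: "('a \<Rightarrow> 'a \<Rightarrow> real) \<Rightarrow> 'a \<times> real \<Rightarrow> 'a \<times> real \<Rightarrow> real" where
  "glued_dist d p q = (if fst p = fst q then \<bar>snd p - snd q\<bar> else snd p + snd q + d (fst p) (fst q))"

locale edges_attached =
  fixes M P :: "'a set" and d :: "'a \<Rightarrow> 'a \<Rightarrow> real" and L :: real
  assumes subset: "P \<subseteq> M"
    and nonneg: "x \<in> M \<Longrightarrow> y \<in> M \<Longrightarrow> 0 \<le> d x y"
    and sym: "x \<in> M \<Longrightarrow> y \<in> M \<Longrightarrow> d x y = d y x"
    and refl: "x \<in> M \<Longrightarrow> d x x = 0"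
    and triangle: "x \<in> M \<Longrightarrow> y \<in> M \<Longrightarrow> z \<in> M \<Longrightarrow> d x z \<le> d x y + d y z"
begin

abbreviation "N \<equiv> attach_edges M P L"

lemma attach_edgesD:
  assumes "p \<in> N"
  shows "fst p \<in> M" "0 \<le> snd p" "(fst p, 0) \<in> N"
  using assms subset by (auto simp: attach_edges_def)

lemma glued_dist_step:
  assumes "p \<in> N" "q \<in> N" "r \<in> N" "same_piece p q"
  shows "glued_dist d p r \<le> piece_dist d p q + glued_dist d q r"
proof -
  note p = attach_edgesD[OF assms(1)] and q = attach_edgesD[OF assms(2)] and r = attach_edgesD[OF assms(3)]
  show ?thesis
    using p(2) q(2) r(2) nonneg[OF p(1) q(1)] nonneg[OF q(1) r(1)] assms(4) triangle[OF p(1) q(1) r(1)]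
    by (auto simp: glued_dist_def piece_dist_def same_piece_def)
qed

lemma glued_dist_le_length:
  assumes "zs \<noteq> []" "set zs \<subseteq> N" "successively same_piece zs"
  shows "glued_dist d (hd zs) (last zs) \<le> (\<Sum>i < length zs - 1. piece_dist d (zs ! i) (zs ! Suc i))"
  using assms
proof (induction zs rule: induct_list012)
  case (3 x y zs)
  have "last (y # zs) \<in> N"
    using 3 last_in_set[of "y # zs"] by auto
  then have "glued_dist d x (last (y # zs)) \<le> piece_dist d x y + glued_dist d y (last (y # zs))"
    using 3 by (intro glued_dist_step) auto
  also have "glued_dist d y (last (y # zs)) \<le> (\<Sum>i < length zs. piece_dist d ((y # zs) ! i) (zs ! i))"
    using 3 by (auto simp: successively_Cons)
  finally show ?case
    by (simp add: sum.lessThan_Suc_shift del: sum.lessThan_Suc)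
qed (auto simp: glued_dist_def)

lemma attach_edges_dist_eq:
  assumes p: "p \<in> N" and q: "q \<in> N"
  shows "attach_edges_dist M d P L p q = glued_dist d p q"
  unfolding attach_edges_dist_def
proof (rule cInf_eq_minimum)
  let ?len = "\<lambda>zs. \<Sum>i < length zs - 1. piece_dist d (zs ! i) (zs ! Suc i)"
  have "\<exists>zs. glued_dist d p q = ?len zs \<and> zs \<noteq> [] \<and> hd zs = p \<and> last zs = q \<and> set zs \<subseteq> N \<and> successively same_piece zs"
  proof (cases "fst p = fst q")
    case True
    then show ?thesis
      using p q by (intro exI[of _ "[p, q]"]) (simp add: glued_dist_def piece_dist_def same_piece_def)
  next
    case False
    then show ?thesis
      using p q attach_edgesD[OF p] attach_edgesD[OF q]
      by (intro exI[of _ "[p, (fst p, 0), (fst q, 0), q]"])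
        (simp add: glued_dist_def piece_dist_def same_piece_def eval_nat_numeral)
  qed
  then show "glued_dist d p q \<in> {?len zs | zs. zs \<noteq> [] \<and> hd zs = p \<and> last zs = q \<and> set zs \<subseteq> N \<and> successively same_piece zs}"
    by blast
qed (use glued_dist_le_length in blast)

text \<open>Only a vertex \<open>p\<close> of maximal height is pushed down, by \<open>\<epsilon>\<close>: its new position is at distance at most
  \<open>s\<close> from all vertices that were at distance at most \<open>s\<close> from \<open>p\<close>. If \<open>s = 0\<close>, the simplices are points and
  every \<open>\<epsilon>\<close> will do.\<close>

lemma move_into_base:
  fixes c :: "('a \<times> real, 'f::field) chain"
  assumes \<epsilon>: "0 < \<epsilon>" "s > 0 \<Longrightarrow> \<epsilon> \<le> s" and s: "0 \<le> s"
    and c: "c \<in> oriented_chains (vietoris_rips N (glued_dist d) s) n"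
    and bc: "vertices (boundary c) \<subseteq> range (\<lambda>x. (x, 0))"
  shows "\<exists>c'\<in>oriented_chains (vietoris_rips N (glued_dist d) s) n. boundary c' = boundary c \<and>
    vertices c' \<subseteq> range (\<lambda>x. (x, 0)) \<and> c - c' \<in> boundaries (vietoris_rips N (glued_dist d) (max s \<epsilon>)) n"
proof (rule move_vertices_into[OF c bc, where \<mu> = "\<lambda>p. nat \<lceil>snd p / \<epsilon>\<rceil>"])
  let ?K = "\<lambda>r. vietoris_rips N (glued_dist d) r"
  fix V :: "('a \<times> real) set"
  assume V: "finite V" "V \<subseteq> \<Union>(?K s)" "\<not> V \<subseteq> range (\<lambda>x. (x, 0))"
  have VN: "V \<subseteq> N"
    using V(2) by (auto simp: vietoris_rips_def)
  obtain p0 where p0: "p0 \<in> V" "snd p0 \<noteq> 0"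
  proof -
    obtain p0 where "p0 \<in> V" "p0 \<notin> range (\<lambda>x. (x, 0))" using V(3) by blast
    then show thesis using that[of p0] by (cases p0) auto
  qed
  have "Max (snd ` V) \<in> snd ` V"
    using V(1) p0 by (intro Max_in) auto
  then obtain p where p: "p \<in> V" "snd p = Max (snd ` V)"
    by auto
  have top: "snd x \<le> snd p" if "x \<in> V" for x
    using V(1) that p(2) by simp
  have pos: "0 < snd p"
    using top[OF p0(1)] p0 attach_edgesD(2)[of p0] VN by fastforce
  define q where "q = (fst p, max 0 (snd p - \<epsilon>))"
  have pN: "p \<in> N" using p VN by auto
  have qN: "q \<in> N"
    using pN pos \<epsilon>(1) by (auto simp: attach_edges_def q_def split: prod.splits)
  have "snd q / \<epsilon> \<le> max 0 (snd p / \<epsilon> - 1)"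
  proof (cases "snd p \<le> \<epsilon>")
    case False
    then have "snd q / \<epsilon> = snd p / \<epsilon> - 1"
      using \<epsilon> by (simp add: q_def diff_divide_distrib)
    then show ?thesis by simp
  qed (simp add: q_def)
  also have "\<dots> \<le> of_int (max 0 (\<lceil>snd p / \<epsilon>\<rceil> - 1))"
    by (simp add: max.coboundedI2 of_int_max)
  finally have "\<lceil>snd q / \<epsilon>\<rceil> \<le> max 0 (\<lceil>snd p / \<epsilon>\<rceil> - 1)"
    by (rule ceiling_le)
  moreover have "0 < \<lceil>snd p / \<epsilon>\<rceil>" using pos \<epsilon> by simp
  ultimately have \<mu>: "nat \<lceil>snd q / \<epsilon>\<rceil> < nat \<lceil>snd p / \<epsilon>\<rceil>"
    by linarith
  have sym': "glued_dist d x y = glued_dist d y x" if "x \<in> N" "y \<in> N" for x y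
    using sym[of "fst x" "fst y"] attach_edgesD(1) that by (auto simp: glued_dist_def)
  have qp: "glued_dist d q p \<le> \<epsilon>" "glued_dist d q q = 0"
    using pos \<epsilon> by (auto simp: glued_dist_def q_def)
  have q: "glued_dist d q x \<le> s" if x: "x \<in> V" "x \<noteq> p" "glued_dist d p x \<le> s" for x
  proof (cases "fst x = fst p")
    case True
    then have "snd x < snd p"
      using top[OF x(1)] x(2) by (cases x; cases p) auto
    then show ?thesis
      using x(3) True \<epsilon> attach_edgesD(2)[of x] x(1) VN by (auto simp: glued_dist_def q_def max_def)
  next
    case False
    then show ?thesis
      using x(3) pos \<epsilon> by (auto simp: glued_dist_def q_def max_def)
  qed
  have "insert q (\<sigma> - {p}) \<in> ?K s \<and> insert q \<sigma> \<in> ?K (max s \<epsilon>)"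
    if \<sigma>: "\<sigma> \<in> ?K s" "\<sigma> \<subseteq> V" "p \<in> \<sigma>" for \<sigma>
  proof -
    have 1: "glued_dist d q x \<le> s" "glued_dist d x q \<le> s" if "x \<in> \<sigma>" "x \<noteq> p" for x
    proof -
      show "glued_dist d q x \<le> s"
        using \<sigma> that by (intro q) (auto simp: vietoris_rips_def)
      then show "glued_dist d x q \<le> s"
        using sym'[OF qN, of x] \<sigma> that VN by auto
    qed
    have 2: "glued_dist d q x \<le> max s \<epsilon>" "glued_dist d x q \<le> max s \<epsilon>" if "x \<in> \<sigma>" for x
      using 1[OF that] qp(1) sym'[OF qN pN] by (cases "x = p"; force)+
    have 3: "glued_dist d x y \<le> max s \<epsilon>" if "x \<in> \<sigma>" "y \<in> \<sigma>" for x y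
      using \<sigma>(1) that by (auto simp: vietoris_rips_def le_max_iff_disj)
    show ?thesis
      using \<sigma>(1) 1 2 3 qp(2) qN s by (auto simp: vietoris_rips_def)
  qed
  then show "\<exists>p\<in>V - range (\<lambda>x. (x, 0)). \<exists>q. nat \<lceil>snd q / \<epsilon>\<rceil> < nat \<lceil>snd p / \<epsilon>\<rceil> \<and>
      (\<forall>\<sigma>\<in>?K s. \<sigma> \<subseteq> V \<longrightarrow> p \<in> \<sigma> \<longrightarrow> insert q (\<sigma> - {p}) \<in> ?K s \<and> insert q \<sigma> \<in> ?K (max s \<epsilon>))"
    using p(1) pos \<mu> by (intro bexI[of _ p] exI[of _ q]) auto
qed

lemma vietoris_rips_negative:
  assumes "r < 0"
  shows "vietoris_rips N (glued_dist d) r = {}"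
proof -
  have "\<not> glued_dist d x x \<le> r" for x :: "'a \<times> real"
    using assms by (simp add: glued_dist_def)
  then show ?thesis
    unfolding vietoris_rips_def by blast
qed

lemma dgm_VR_attach_edges:
  "dgm_VR TYPE('f::field) j M d = dgm_VR TYPE('f) j N (attach_edges_dist M d P L)"
proof (rule dgm_VR_cong)
  fix s t :: real
  assume st: "s < t"
  let ?K = "\<lambda>r. vietoris_rips N (glued_dist d) r"
  let ?f = "\<lambda>x::'a. (x, 0::real)"
  have inj: "inj ?f" by (auto simp: inj_on_def)
  have K: "vietoris_rips N (attach_edges_dist M d P L) r = ?K r" for r
    unfolding vietoris_rips_def
    by (intro Collect_cong conj_cong ball_cong HOL.refl) (simp add: attach_edges_dist_eq subsetD)
  have "glued_dist d (x, 0) (y, 0) = d x y" if "x \<in> M" for x y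
    using refl[OF that] by (auto simp: glued_dist_def)
  then have fK: "?f ` \<sigma> \<in> ?K r \<longleftrightarrow> \<sigma> \<in> vietoris_rips M d r" for \<sigma> r
    by (auto simp: vietoris_rips_def attach_edges_def finite_image_iff[OF inj_on_subset[OF inj]] subset_eq)
  show "vr_rank TYPE('f) j M d s t = vr_rank TYPE('f) j N (attach_edges_dist M d P L) s t"
    unfolding vr_rank_def K
  proof (rule quotient_dim_push[OF inj fK fK])
    fix z :: "('a \<times> real, 'f) chain"
    assume z: "z \<in> cycles (?K s) j"
    then have zo: "z \<in> oriented_chains (?K s) j" and bz: "boundary z = 0"
      by (auto simp: cycles_def)
    show "\<exists>z'\<in>cycles (?K s) j. vertices z' \<subseteq> range ?f \<and> z - z' \<in> boundaries (?K t) j"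
    proof (cases "s < 0")
      case True
      then have "z = 0"
        using zo by (simp add: vietoris_rips_negative oriented_chains_empty)
      then show ?thesis
        using z linear_subspaceD(1)[OF boundaries_linear_subspace]
        by (intro bexI[of _ 0]) auto
    next
      case False
      define \<epsilon> where "\<epsilon> = (if s = 0 then t else s)"
      have "0 < \<epsilon>" "\<And>u. s > 0 \<Longrightarrow> \<epsilon> \<le> s" "0 \<le> s" "max s \<epsilon> \<le> t" "vertices (boundary z) \<subseteq> range ?f"
        using False st bz by (auto simp: \<epsilon>_def)
      from move_into_base[OF this(1,2,3) zo this(5)] obtain z' where
        "z' \<in> oriented_chains (?K s) j" "boundary z' = boundary z" "vertices z' \<subseteq> range ?f"
        "z - z' \<in> boundaries (?K (max s \<epsilon>)) j" by blast
      moreover have "boundaries (?K (max s \<epsilon>)) j \<subseteq> (boundaries (?K t) j :: ('a \<times> real, 'f) chain set)"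
        by (intro boundaries_mono vietoris_rips_mono \<open>max s \<epsilon> \<le> t\<close>)
      ultimately show ?thesis
        using bz by (intro bexI[of _ z']) (auto simp: cycles_def)
    qed
  next
    fix w :: "('a \<times> real, 'f) chain"
    assume w: "w \<in> oriented_chains (?K t) (Suc j)" and bw: "vertices (boundary w) \<subseteq> range ?f"
    show "\<exists>w'\<in>oriented_chains (?K t) (Suc j). boundary w' = boundary w \<and> vertices w' \<subseteq> range ?f"
    proof (cases "t < 0")
      case True
      then have "w = 0"
        using w by (simp add: vietoris_rips_negative oriented_chains_empty)
      then show ?thesis
        using w by (intro bexI[of _ w]) auto
    next
      case False
      define \<epsilon> where "\<epsilon> = (if t = 0 then 1 else t)"
      have "0 < \<epsilon>" "\<And>u. t > 0 \<Longrightarrow> \<epsilon> \<le> t" "0 \<le> t"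
        using False by (auto simp: \<epsilon>_def)
      from move_into_base[OF this w bw] show ?thesis by blast
    qed
  qed
qed

end

section \<open>The geodesic distance of the sphere\<close>

lemma unit_sphereD: "x \<in> unit_sphere k \<Longrightarrow> (\<Sum>i\<le>k. x i * x i) = 1"
  by (simp add: nsphere power2_eq_square)

lemma inner_le_1:
  assumes "x \<in> unit_sphere k" "y \<in> unit_sphere k"
  shows "\<bar>\<Sum>i\<le>k. x i * y i\<bar> \<le> 1"
proof -
  have "(\<Sum>i\<le>k. x i * y i)\<^sup>2 \<le> (\<Sum>i\<le>k. (x i)\<^sup>2) * (\<Sum>i\<le>k. (y i)\<^sup>2)"
    by (rule Cauchy_Schwarz_ineq_sum)
  then have "(\<Sum>i\<le>k. x i * y i)\<^sup>2 \<le> 1"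
    using unit_sphereD[OF assms(1)] unit_sphereD[OF assms(2)] by (simp add: power2_eq_square)
  then show ?thesis
    by (simp add: abs_square_le_1)
qed

text \<open>For unit vectors with inner products \<open>a = x \<bullet> y\<close> and \<open>b = y \<bullet> z\<close>, apply the Cauchy-Schwarz
  inequality to the components \<open>x - a y\<close> and \<open>z - b y\<close> orthogonal to \<open>y\<close>.\<close>

lemma sphere_geodesic_triangle:
  assumes x: "x \<in> unit_sphere k" and y: "y \<in> unit_sphere k" and z: "z \<in> unit_sphere k"
  shows "sphere_geodesic k x z \<le> sphere_geodesic k x y + sphere_geodesic k y z"
proof -
  define a b c where "a = (\<Sum>i\<le>k. x i * y i)" and "b = (\<Sum>i\<le>k. y i * z i)" and "c = (\<Sum>i\<le>k. x i * z i)"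
  have bounds: "\<bar>a\<bar> \<le> 1" "\<bar>b\<bar> \<le> 1" "\<bar>c\<bar> \<le> 1"
    using inner_le_1 x y z by (auto simp: a_def b_def c_def)
  note n = unit_sphereD[OF x] unit_sphereD[OF y] unit_sphereD[OF z]
  have "(\<Sum>i\<le>k. (x i - a * y i) * (z i - b * y i)) =
      (\<Sum>i\<le>k. x i * z i) - b * (\<Sum>i\<le>k. x i * y i) - a * (\<Sum>i\<le>k. y i * z i) + a * b * (\<Sum>i\<le>k. y i * y i)"
    by (simp add: sum_distrib_left sum.distrib sum_subtractf algebra_simps)
  then have xz: "(\<Sum>i\<le>k. (x i - a * y i) * (z i - b * y i)) = c - a * b"
    using n by (simp add: a_def[symmetric] b_def[symmetric] c_def[symmetric])
  have "(\<Sum>i\<le>k. (x i - a * y i)\<^sup>2) =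
      (\<Sum>i\<le>k. x i * x i) - 2 * a * (\<Sum>i\<le>k. x i * y i) + a * a * (\<Sum>i\<le>k. y i * y i)"
    by (simp add: sum_distrib_left sum.distrib sum_subtractf algebra_simps power2_eq_square)
  then have xx: "(\<Sum>i\<le>k. (x i - a * y i)\<^sup>2) = 1 - a\<^sup>2"
    using n by (simp add: a_def[symmetric] power2_eq_square)
  have "(\<Sum>i\<le>k. (z i - b * y i)\<^sup>2) =
      (\<Sum>i\<le>k. z i * z i) - 2 * b * (\<Sum>i\<le>k. y i * z i) + b * b * (\<Sum>i\<le>k. y i * y i)"
    by (simp add: sum_distrib_left sum.distrib sum_subtractf algebra_simps power2_eq_square)
  then have zz: "(\<Sum>i\<le>k. (z i - b * y i)\<^sup>2) = 1 - b\<^sup>2"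
    using n by (simp add: b_def[symmetric] power2_eq_square)
  have "(c - a * b)\<^sup>2 \<le> (1 - a\<^sup>2) * (1 - b\<^sup>2)"
    using Cauchy_Schwarz_ineq_sum[of "\<lambda>i. x i - a * y i" "\<lambda>i. z i - b * y i" "{..k}"]
    by (simp only: xz xx zz)
  then have "\<bar>c - a * b\<bar> \<le> sqrt (1 - a\<^sup>2) * sqrt (1 - b\<^sup>2)"
    using real_le_rsqrt[of "\<bar>c - a * b\<bar>" "(1 - a\<^sup>2) * (1 - b\<^sup>2)"] by (simp add: real_sqrt_mult)
  then have "a * b - sqrt (1 - a\<^sup>2) * sqrt (1 - b\<^sup>2) \<le> c"
    by linarith
  moreover have "cos (arccos a + arccos b) = a * b - sqrt (1 - a\<^sup>2) * sqrt (1 - b\<^sup>2)"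
    using bounds by (simp add: cos_add sin_arccos_abs cos_arccos_abs)
  ultimately have le: "cos (arccos a + arccos b) \<le> c"
    by simp
  have "arccos c \<le> arccos a + arccos b"
  proof (cases "arccos a + arccos b \<le> pi")
    case True
    moreover have "0 \<le> arccos a + arccos b"
      using arccos_lbound[of a] arccos_lbound[of b] bounds by (simp add: abs_le_iff)
    ultimately have "arccos (cos (arccos a + arccos b)) = arccos a + arccos b"
      by (simp add: arccos_cos)
    then show ?thesis
      using arccos_le_mono[of c "cos (arccos a + arccos b)"] le bounds by simp
  next
    case False
    moreover have "arccos c \<le> pi"
      using arccos_ubound[of c] bounds by (simp add: abs_le_iff)
    ultimately show ?thesis by simp
  qed
  then show ?thesis
    by (simp add: sphere_geodesic_def a_def b_def c_def)
qed

lemma sphere_geodesic_bounds: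
  assumes "x \<in> unit_sphere k" "y \<in> unit_sphere k"
  shows "0 \<le> sphere_geodesic k x y" "sphere_geodesic k x y \<le> pi"
  using inner_le_1[OF assms] arccos_lbound arccos_ubound by (auto simp: sphere_geodesic_def abs_le_iff)

lemma cross_polytope_vertices_subset: "cross_polytope_vertices k \<subseteq> unit_sphere k"
proof
  fix v assume "v \<in> cross_polytope_vertices k"
  then obtain i s where v: "v = (\<lambda>j. if j = i then s else 0)" "i \<le> k" "s = 1 \<or> s = -1"
    by (auto simp: cross_polytope_vertices_def)
  have "(\<Sum>j\<le>k. (v j)\<^sup>2) = (\<Sum>j\<le>k. if j = i then 1 else 0)"
    using v by (intro sum.cong) auto
  then show "v \<in> unit_sphere k"
    using v by (auto simp: nsphere)
qed

lemma edges_attached_sphere: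
  "edges_attached (unit_sphere k) (cross_polytope_vertices k) (sphere_geodesic k)"
proof
  show "sphere_geodesic k x x = 0" if "x \<in> unit_sphere k" for x
    using unit_sphereD[OF that] by (simp add: sphere_geodesic_def)
  show "sphere_geodesic k x y = sphere_geodesic k y x" for x y
    by (simp add: sphere_geodesic_def mult.commute)
qed (use cross_polytope_vertices_subset sphere_geodesic_bounds sphere_geodesic_triangle in blast)+

section \<open>Homology of cones and of the cross-polytope\<close>

lemma cycle_is_boundary_of_cone:
  fixes c :: "('a, 'f::field) chain"
  assumes c: "c \<in> cycles K j" and K: "\<And>\<sigma>. \<sigma> \<in> K \<Longrightarrow> insert q \<sigma> \<in> K'"
  shows "c \<in> boundaries K' j"
proof -
  define V where "V = insert q (vertices c)"
  define d where "d = Abs_poly_mapping (wedge q (Poly_Mapping.lookup c))"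
  have V: "finite V" "q \<in> V" "vertices c \<subseteq> V"
    by (auto simp: V_def)
  have co: "c \<in> oriented_chains K j" and bc: "boundary c = 0"
    using c by (auto simp: cycles_def)
  have supp: "length xs = Suc (Suc j) \<and> set xs \<in> K' \<and> set xs \<subseteq> V"
    if nz: "wedge q (Poly_Mapping.lookup c) xs \<noteq> 0" for xs
  proof -
    from wedge_support[OF nz] obtain us vs where xs: "xs = us @ q # vs" and nz': "Poly_Mapping.lookup c (us @ vs) \<noteq> 0"
      by (elim exE conjE)
    have "set xs = insert q (set (us @ vs))"
      by (auto simp: xs)
    moreover have "length xs = Suc (Suc j)" "set (us @ vs) \<in> K"
      using co nz' by (auto simp: oriented_chains_iff xs)
    ultimately show ?thesis
      using K vertices_subset[OF nz'] V by auto
  qed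
  have d_w: "Poly_Mapping.lookup d = wedge q (Poly_Mapping.lookup c)"
    unfolding d_def using supp by (intro lookup_Abs_chain[OF V(1)]) auto
  have d: "d \<in> oriented_chains K' (Suc j)"
    using supp co by (auto simp: oriented_chains_iff d_w intro: alternating_wedge)
  have "vertices d \<subseteq> V"
    using supp by (fastforce simp: vertices_iff d_w)
  note bd = lookup_boundary_oriented[OF d V(1) this]
  have "face_sum V (Poly_Mapping.lookup c) = (\<lambda>_. 0)"
    using lookup_boundary_oriented[OF co V(1,3)] bc by (simp add: fun_eq_iff)
  then have "boundary d = c"
    by (intro poly_mapping_eqI) (simp add: bd d_w face_sum_wedge[OF V(1,2)] wedge_linear)
  then show ?thesis
    using d by (auto simp: boundaries_def)
qed

lemma alternating_mset_eq:
  assumes "alternating f" "mset xs = mset ys" "f ys = 0"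
  shows "f xs = 0"
proof -
  obtain p where "p permutes {..<length ys}" "permute_list p ys = xs"
    using mset_eq_permutation[OF assms(2)] by blast
  then show ?thesis
    using alternating_permute[OF assms(1), of p ys] assms(3) by simp
qed

locale cross_polytope =
  fixes k :: nat and pos neg :: "nat \<Rightarrow> 'a" and idx :: "'a \<Rightarrow> nat"
  assumes idx_pos: "i \<le> k \<Longrightarrow> idx (pos i) = i" and idx_neg: "i \<le> k \<Longrightarrow> idx (neg i) = i"
    and pos_neq_neg: "i \<le> k \<Longrightarrow> pos i \<noteq> neg i"
begin

definition "W = pos ` {..k} \<union> neg ` {..k}"

definition "C = {\<sigma>. finite \<sigma> \<and> \<sigma> \<noteq> {} \<and> \<sigma> \<subseteq> W \<and> inj_on idx \<sigma>}"

lemma finite_W: "finite W"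
  by (simp add: W_def)

lemma idx_le: "x \<in> W \<Longrightarrow> idx x \<le> k"
  by (auto simp: W_def idx_pos idx_neg)

lemma W_cases: "x \<in> W \<Longrightarrow> x = pos (idx x) \<or> x = neg (idx x)"
  by (auto simp: W_def idx_pos idx_neg)

text \<open>The fundamental cycle is the iterated join of the \<open>0\<close>-spheres \<open>pos i - neg i\<close>.\<close>

fun join_cycle :: "nat \<Rightarrow> 'a list \<Rightarrow> 'f::field" where
  "join_cycle 0 xs = (if xs = [] then 1 else 0)"
| "join_cycle (Suc i) xs = wedge (pos i) (join_cycle i) xs - wedge (neg i) (join_cycle i) xs"

lemma alternating_join_cycle: "alternating (join_cycle i)"
proof (induction i)
  case 0
  show ?case by (simp add: alternating_def)
next
  case (Suc i)
  note w = alternatingD(1,2)[OF alternating_wedge[OF Suc]]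
  show ?case
    unfolding alternating_def join_cycle.simps
  proof (intro conjI allI)
    fix us vs and a b :: 'a
    show "wedge (pos i) (join_cycle i) (us @ a # b # vs) - wedge (neg i) (join_cycle i) (us @ a # b # vs)
      = - (wedge (pos i) (join_cycle i) (us @ b # a # vs) - wedge (neg i) (join_cycle i) (us @ b # a # vs) :: 'b)"
      using w(1)[of "pos i" us a b vs] w(1)[of "neg i" us a b vs] by simp
  qed (simp add: w(2))
qed

lemma join_cycle_support:
  "i \<le> Suc k \<Longrightarrow> join_cycle i xs \<noteq> (0 :: 'f::field) \<Longrightarrow> length xs = i \<and> set xs \<subseteq> W \<and> idx ` set xs = {..<i}"
proof (induction i arbitrary: xs)
  case (Suc i)
  then have "wedge (pos i) (join_cycle i) xs \<noteq> (0 :: 'f) \<or> wedge (neg i) (join_cycle i) xs \<noteq> (0 :: 'f)"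
    by auto
  then obtain q us vs where q: "q = pos i \<or> q = neg i" and xs: "xs = us @ q # vs"
    and nz: "join_cycle i (us @ vs) \<noteq> (0 :: 'f)"
    by (metis wedge_support)
  have ih: "length (us @ vs) = i \<and> set (us @ vs) \<subseteq> W \<and> idx ` set (us @ vs) = {..<i}"
    using Suc.prems(1) by (intro Suc.IH[OF _ nz]) simp
  have "q \<in> W" "idx q = i"
    using q Suc.prems(1) by (auto simp: W_def idx_pos idx_neg)
  moreover have "set xs = insert q (set (us @ vs))"
    by (auto simp: xs)
  ultimately show ?case
    using ih by (auto simp: xs lessThan_Suc)
qed (simp split: if_splits)

lemma face_sum_join_cycle: "i \<le> Suc k \<Longrightarrow> face_sum W (join_cycle i) = (\<lambda>_. 0 :: 'f::field)"
proof (induction i)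
  case 0
  show ?case by (simp add: face_sum_def fun_eq_iff)
next
  case (Suc i)
  have pW: "pos i \<in> W" "neg i \<in> W"
    using Suc.prems by (auto simp: W_def)
  show ?case
  proof
    fix xs
    have "(face_sum W (join_cycle (Suc i)) xs :: 'f)
        = face_sum W (wedge (pos i) (join_cycle i)) xs - face_sum W (wedge (neg i) (join_cycle i)) xs"
      by (simp add: face_sum_def sum_subtractf)
    also have "\<dots> = 0"
      using Suc by (simp add: face_sum_wedge[OF finite_W pW(1)] face_sum_wedge[OF finite_W pW(2)] wedge_linear)
    finally show "face_sum W (join_cycle (Suc i)) xs = (0 :: 'f)" .
  qed
qed

fun facet :: "nat \<Rightarrow> 'a list" where
  "facet 0 = []"
| "facet (Suc i) = pos i # facet i"

lemma set_facet: "set (facet i) = pos ` {..<i}"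
  by (induction i) (auto simp: lessThan_Suc)

lemma distinct_facet: "i \<le> Suc k \<Longrightarrow> distinct (facet i)"
  by (induction i) (fastforce simp: set_facet dest: arg_cong[of _ _ idx] simp: idx_pos)+

lemma join_cycle_facet: "i \<le> Suc k \<Longrightarrow> join_cycle i (facet i) = 1"
proof (induction i)
  case (Suc i)
  have z: "join_cycle i (pos i # ys) = (0 :: 'b)" for ys
    using join_cycle_support[of i "pos i # ys"] Suc.prems idx_pos[of i] by fastforce
  have "wedge (neg i) (join_cycle i) (pos i # facet i) = (0 :: 'b)"
    using pos_neq_neg[of i] Suc.prems by (simp add: z wedge_linear)
  then show ?case
    using Suc by (simp add: z wedge_linear)
qed simp

lemma vanishing_cycle:
  fixes y :: "('a, 'f::field) chain"
  assumes y: "y \<in> cycles C k" and y0: "Poly_Mapping.lookup y (facet (Suc k)) = 0"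
  shows "y = 0"
proof (rule poly_mapping_eqI)
  have yo: "y \<in> oriented_chains C k" and by0: "boundary y = 0"
    using y by (auto simp: cycles_def)
  then have alt: "alternating (Poly_Mapping.lookup y)"
    by (simp add: oriented_chains_iff)
  have supp: "length xs = Suc k \<and> set xs \<subseteq> W \<and> inj_on idx (set xs) \<and> distinct xs"
    if "Poly_Mapping.lookup y xs \<noteq> 0" for xs
    using that yo alternating_distinct[OF alt] by (auto simp: oriented_chains_iff C_def)
  have "vertices y \<subseteq> W"
    using supp by (fastforce simp: vertices_iff)
  then have face: "face_sum W (Poly_Mapping.lookup y) ys = 0" for ys
    using lookup_boundary_oriented[OF yo finite_W] by0 by (metis lookup_zero)
  fix xs
  have "Poly_Mapping.lookup y xs = 0"
  proof (induction "card (set xs \<inter> neg ` {..k})" arbitrary: xs rule: less_induct)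
    case less
    show ?case
    proof (rule ccontr)
      assume nz: "Poly_Mapping.lookup y xs \<noteq> 0"
      note s = supp[OF nz]
      have card: "card (idx ` set xs) = Suc k"
        using s by (simp add: card_image distinct_card)
      have sub: "idx ` set xs \<subseteq> {..k}"
        using s idx_le by auto
      have all: "idx ` set xs = {..k}"
        using card sub by (intro card_subset_eq) auto
      show False
      proof (cases "set xs \<inter> neg ` {..k} = {}")
        case True
        have "set xs = pos ` {..<Suc k}"
        proof
          show "set xs \<subseteq> pos ` {..<Suc k}"
            using s True unfolding W_def lessThan_Suc_atMost by blast
          have "pos i \<in> set xs" if i: "i \<le> k" for i
          proof -
            obtain x where x: "x \<in> set xs" "idx x = i"
              using all i by (metis atMost_iff imageE)
            then have "x = pos i"
              using W_cases[of x] s True i by auto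
            then show ?thesis using x by simp
          qed
          then show "pos ` {..<Suc k} \<subseteq> set xs" by auto
        qed
        then have "mset xs = mset (facet (Suc k))"
          using s distinct_facet[of "Suc k"] by (intro set_eq_iff_mset_eq_distinct[THEN iffD1]) (simp_all add: set_facet del: facet.simps)
        then show False
          using alternating_mset_eq[OF alt _ y0] nz by blast
      next
        case False
        then obtain i where i: "i \<le> k" "neg i \<in> set xs" by auto
        then obtain us vs where xs: "xs = us @ neg i # vs"
          by (meson split_list)
        let ?ys = "us @ vs"
        have mset: "mset xs = mset (neg i # ?ys)"
          by (simp add: xs)
        have nz': "Poly_Mapping.lookup y (neg i # ?ys) \<noteq> 0"
          using alternating_mset_eq[OF alt mset] nz by blast
        have inj: "idx ` set ?ys = {..k} - {i}"
        proof -
          have "set ?ys = set xs - {neg i}"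
            using s by (auto simp: xs)
          then have "idx ` set ?ys = idx ` set xs - idx ` {neg i}"
            using s i by (simp add: inj_on_image_set_diff[of idx "set xs"])
          then show ?thesis
            using i by (simp add: all idx_neg)
        qed
        have w: "w = pos i \<or> w = neg i" if nz: "Poly_Mapping.lookup y (w # ?ys) \<noteq> 0" for w
        proof -
          have "idx w \<notin> idx ` set ?ys" "w \<in> W"
            using supp[OF nz] by (auto simp: inj_on_def)
          then have "idx w = i"
            using inj idx_le[of w] by auto
          then show ?thesis using W_cases \<open>w \<in> W\<close> by metis
        qed
        have "0 = (\<Sum>w\<in>W. Poly_Mapping.lookup y (w # ?ys))"
          using face[of ?ys] by (simp add: face_sum_def)
        also have "\<dots> = (\<Sum>w\<in>{pos i, neg i}. Poly_Mapping.lookup y (w # ?ys))"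
          using w i finite_W by (intro sum.mono_neutral_right) (auto simp: W_def)
        also have "\<dots> = Poly_Mapping.lookup y (pos i # ?ys) + Poly_Mapping.lookup y (neg i # ?ys)"
          using pos_neq_neg[OF i(1)] by simp
        also have "Poly_Mapping.lookup y (pos i # ?ys) = 0"
        proof (rule less)
          have "pos i \<notin> neg ` {..k}"
            using i pos_neq_neg[of i] idx_pos[of i] by (auto simp: idx_neg)
          then have "set (pos i # ?ys) \<inter> neg ` {..k} \<subseteq> set xs \<inter> neg ` {..k} - {neg i}"
            using s by (auto simp: xs)
          then have "card (set (pos i # ?ys) \<inter> neg ` {..k}) \<le> card (set xs \<inter> neg ` {..k} - {neg i})"
            by (intro card_mono) auto
          also have "\<dots> < card (set xs \<inter> neg ` {..k})"
            using i by (intro card_Diff1_less) auto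
          finally show "card (set (pos i # ?ys) \<inter> neg ` {..k}) < card (set xs \<inter> neg ` {..k})" .
        qed
        finally show False using nz' by simp
      qed
    qed
  qed
  then show "Poly_Mapping.lookup y xs = Poly_Mapping.lookup 0 xs" by simp
qed

lemma boundaries_C: "boundaries C k = {0 :: ('a, 'f::field) chain}"
proof -
  have "c = 0" if c: "c \<in> oriented_chains C (Suc k)" for c :: "('a, 'f) chain"
  proof (rule poly_mapping_eqI)
    fix xs
    show "Poly_Mapping.lookup c xs = Poly_Mapping.lookup 0 xs"
    proof (rule ccontr)
      assume "Poly_Mapping.lookup c xs \<noteq> Poly_Mapping.lookup 0 xs"
      then have xs: "length xs = Suc (Suc k)" "set xs \<subseteq> W" "inj_on idx (set xs)" "distinct xs"
        using c alternating_distinct[of "Poly_Mapping.lookup c" xs] by (auto simp: oriented_chains_iff C_def)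
      have "card (idx ` set xs) \<le> card {..k}"
        using xs idx_le by (intro card_mono) auto
      then show False
        using xs by (simp add: card_image distinct_card)
    qed
  qed
  moreover have "0 \<in> oriented_chains C (Suc k)"
    by (rule linear_subspaceD(1)[OF oriented_chains_linear_subspace])
  ultimately have "oriented_chains C (Suc k) = {0 :: ('a, 'f) chain}"
    by blast
  then show ?thesis by (simp add: boundaries_def)
qed

lemma quotient_dim_cross_polytope:
  "quotient_dim (cycles C k :: ('a, 'f::field) chain set) (boundaries C k) = 1"
proof -
  define \<phi> :: "('a, 'f) chain" where "\<phi> = Abs_poly_mapping (join_cycle (Suc k))"
  have supp: "length xs = Suc k \<and> set xs \<subseteq> W \<and> set xs \<in> C" if nz: "join_cycle (Suc k) xs \<noteq> (0 :: 'f)" for xs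
  proof -
    have s: "length xs = Suc k" "set xs \<subseteq> W" "idx ` set xs = {..<Suc k}"
      using join_cycle_support[OF order_refl nz] by auto
    have "card (set xs) \<le> card (idx ` set xs)"
      using card_length[of xs] s by simp
    then have "inj_on idx (set xs)"
      using card_image_le[of "set xs" idx] by (intro eq_card_imp_inj_on) auto
    moreover have "set xs \<noteq> {}"
      using s(1) by auto
    ultimately show ?thesis
      using s by (simp add: C_def)
  qed
  have \<phi>: "Poly_Mapping.lookup \<phi> = join_cycle (Suc k)"
    unfolding \<phi>_def using supp by (intro lookup_Abs_chain[OF finite_W]) auto
  have \<phi>o: "\<phi> \<in> oriented_chains C k"
    using supp by (simp add: oriented_chains_iff \<phi> alternating_join_cycle del: join_cycle.simps)
  have "vertices \<phi> \<subseteq> W"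
    using supp by (fastforce simp: vertices_iff \<phi> simp del: join_cycle.simps)
  then have "Poly_Mapping.lookup (boundary \<phi>) = (\<lambda>_. 0)"
    using lookup_boundary_oriented[OF \<phi>o finite_W] by (simp add: \<phi> face_sum_join_cycle del: join_cycle.simps)
  then have \<phi>c: "\<phi> \<in> cycles C k"
    using \<phi>o by (auto simp: cycles_def intro: poly_mapping_eqI)
  have \<phi>1: "Poly_Mapping.lookup \<phi> (facet (Suc k)) = 1"
    unfolding \<phi> by (rule join_cycle_facet) simp
  show ?thesis
  proof (rule quotient_dim_eq_1[OF cycles_linear_subspace boundaries_linear_subspace \<phi>c])
    show "\<phi> \<notin> boundaries C k"
      using \<phi>1 unfolding boundaries_C by auto
    fix z :: "('a, 'f) chain"
    assume z: "z \<in> cycles C k"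
    let ?r = "Poly_Mapping.lookup z (facet (Suc k))"
    have "z - scale ?r \<phi> \<in> cycles C k"
      using linear_subspaceD(3,5)[OF cycles_linear_subspace] z \<phi>c by blast
    then have "z - scale ?r \<phi> = 0"
      by (rule vanishing_cycle) (simp add: lookup_minus \<phi>1 del: facet.simps)
    then show "\<exists>r. z - scale r \<phi> \<in> boundaries C k"
      unfolding boundaries_C by blast
  qed
qed

end

section \<open>Sphere and spiked sphere\<close>

lemma vr_rank_eq_0_if_full:
  assumes "s \<le> t" and full: "\<And>x y. x \<in> M \<Longrightarrow> y \<in> M \<Longrightarrow> d x y \<le> t"
  shows "vr_rank TYPE('f::field) j M d s t = 0"
  unfolding vr_rank_def
proof (rule quotient_dim_eq_0[OF cycles_linear_subspace boundaries_linear_subspace], rule subsetI)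
  fix c :: "('a, 'f) chain"
  assume c: "c \<in> cycles (vietoris_rips M d s) j"
  show "c \<in> boundaries (vietoris_rips M d t) j"
  proof (cases "M = {}")
    case True
    then have "vietoris_rips M d s = {}"
      by (auto simp: vietoris_rips_def)
    then have "c = 0"
      using c by (auto simp: cycles_def oriented_chains_iff intro: poly_mapping_eqI)
    then show ?thesis
      using linear_subspaceD(1)[OF boundaries_linear_subspace] by auto
  next
    case False
    then obtain q where q: "q \<in> M" by blast
    show ?thesis
    proof (rule cycle_is_boundary_of_cone[OF c, of q])
      fix \<sigma> assume "\<sigma> \<in> vietoris_rips M d s"
      then have "finite \<sigma>" "\<sigma> \<subseteq> M"
        by (auto simp: vietoris_rips_def)
      then show "insert q \<sigma> \<in> vietoris_rips M d t"
        unfolding vietoris_rips_def using q full by (auto simp: subset_iff)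
    qed
  qed
qed

lemma vr_rank_eq_0_if_discrete:
  assumes "s \<le> t" "1 \<le> j" and discrete: "\<And>x y. x \<in> M \<Longrightarrow> y \<in> M \<Longrightarrow> x \<noteq> y \<Longrightarrow> s < d x y"
  shows "vr_rank TYPE('f::field) j M d s t = 0"
  unfolding vr_rank_def
proof (rule quotient_dim_eq_0[OF cycles_linear_subspace boundaries_linear_subspace], rule subsetI)
  fix c :: "('a, 'f) chain"
  assume c: "c \<in> cycles (vietoris_rips M d s) j"
  have "Poly_Mapping.lookup c xs = 0" for xs
  proof (rule ccontr)
    assume nz: "Poly_Mapping.lookup c xs \<noteq> 0"
    then have xs: "length xs = Suc j" "set xs \<in> vietoris_rips M d s" "distinct xs"
      using c alternating_distinct[of "Poly_Mapping.lookup c" xs] by (auto simp: cycles_def oriented_chains_iff)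
    then have ne: "xs ! 0 \<noteq> xs ! 1" and mem: "xs ! 0 \<in> set xs" "xs ! 1 \<in> set xs"
      using \<open>1 \<le> j\<close> by (auto simp: nth_eq_iff_index_eq)
    have "d (xs ! 0) (xs ! 1) \<le> s" "xs ! 0 \<in> M" "xs ! 1 \<in> M"
      using xs(2) mem unfolding vietoris_rips_def by blast+
    then show False
      using discrete ne by fastforce
  qed
  then have "c = 0"
    by (intro poly_mapping_eqI) simp
  then show "c \<in> boundaries (vietoris_rips M d t) j"
    using linear_subspaceD(1)[OF boundaries_linear_subspace] by auto
qed

lemma dgm_VR_eq_0:
  assumes "p < q" "\<delta> < q" and full: "\<And>x y. x \<in> M \<Longrightarrow> y \<in> M \<Longrightarrow> d x y \<le> \<delta>"
  shows "dgm_VR TYPE('f::field) j M d (p, ereal q) = 0"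
proof -
  define c where "c = max \<delta> ((p + q) / 2)"
  define b where "b = (p + c) / 2"
  have c: "p < c" "c < q" "\<delta> \<le> c"
    using assms(1,2) by (auto simp: c_def less_max_iff_disj)
  have *: "p - 1 < p \<and> p < b \<and> b < c \<and> ereal c < ereal q \<and> (ereal q < \<infinity> \<or> (\<infinity>::ereal) = \<infinity>)"
    using c by (simp add: b_def)
  have "vr_rank TYPE('f) j M d s c = 0" if "s \<le> c" for s
    using that full c(3) by (intro vr_rank_eq_0_if_full) (auto intro: order_trans)
  then have "nat (vr_measure TYPE('f) j M d (p - 1) b c \<infinity>) = 0"
    using * by (simp add: vr_measure_def vr_rank_ext_def)
  then have "0 \<in> {nat (vr_measure TYPE('f) j M d a b c e) | a b c e.
      a < p \<and> p < b \<and> b < c \<and> ereal c < ereal q \<and> (ereal q < e \<or> e = \<infinity>)}"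
    using * by (intro CollectI exI[of _ "p - 1"] exI[of _ b] exI[of _ c] exI[of _ \<infinity>]) simp
  then have "Inf {nat (vr_measure TYPE('f) j M d a b c e) | a b c e.
      a < p \<and> p < b \<and> b < c \<and> ereal c < ereal q \<and> (ereal q < e \<or> e = \<infinity>)} \<le> 0"
    by (rule cInf_lower) simp
  then show ?thesis
    using assms(1) by (simp add: dgm_VR_apply)
qed

lemma dgm_VR_eq_1:
  assumes "p < q"
    and before: "\<And>s t. s < p \<Longrightarrow> s \<le> t \<Longrightarrow> vr_rank TYPE('f::field) j M d s t = 0"
    and between: "\<And>s t. p \<le> s \<Longrightarrow> s \<le> t \<Longrightarrow> t < q \<Longrightarrow> vr_rank TYPE('f) j M d s t = 1"
    and after: "\<And>s t. q \<le> t \<Longrightarrow> s \<le> t \<Longrightarrow> vr_rank TYPE('f) j M d s t = 0"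
  shows "dgm_VR TYPE('f) j M d (p, ereal q) = 1"
proof -
  let ?S = "{nat (vr_measure TYPE('f) j M d a b c e) | a b c e.
      a < p \<and> p < b \<and> b < c \<and> ereal c < ereal q \<and> (ereal q < e \<or> e = \<infinity>)}"
  have 1: "nat (vr_measure TYPE('f) j M d a b c e) = 1"
    if "a < p \<and> p < b \<and> b < c \<and> ereal c < ereal q \<and> (ereal q < e \<or> e = \<infinity>)" for a b c e
  proof -
    have "vr_rank_ext TYPE('f) j M d b (ereal c) = 1" "vr_rank_ext TYPE('f) j M d a (ereal c) = 0"
      using that by (auto simp: vr_rank_ext_def before between)
    moreover have "vr_rank_ext TYPE('f) j M d s e = 0" if "s < c" for s
      using \<open>a < p \<and> p < b \<and> b < c \<and> ereal c < ereal q \<and> (ereal q < e \<or> e = \<infinity>)\<close> that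
      by (cases e) (auto simp: vr_rank_ext_def after)
    ultimately show ?thesis
      using that by (simp add: vr_measure_def)
  qed
  have "p - 1 < p \<and> p < (2 * p + q) / 3 \<and> (2 * p + q) / 3 < (p + q) / 2 \<and> ereal ((p + q) / 2) < ereal q \<and>
      (ereal q < \<infinity> \<or> (\<infinity>::ereal) = \<infinity>)"
    using assms(1) by (simp add: field_simps)
  then have "?S \<noteq> {}" by blast
  then have "Inf ?S \<in> ?S" by (rule Inf_nat_def1)
  then have "Inf ?S = 1" using 1 by auto
  then show ?thesis
    using assms(1) unfolding dgm_VR_apply by simp
qed

abbreviation axis_vector :: "nat \<Rightarrow> real \<Rightarrow> nat \<Rightarrow> real" where
  "axis_vector i s \<equiv> (\<lambda>j. if j = i then s else 0)"

lemma sphere_geodesic_axis_vectors: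
  assumes "i \<le> k"
  shows "sphere_geodesic k (axis_vector i s) (axis_vector i' s') = arccos (if i = i' then s * s' else 0)"
proof -
  have "(\<Sum>j\<le>k. axis_vector i s j * axis_vector i' s' j) = (\<Sum>j\<le>k. if j = i then (if i = i' then s * s' else 0) else 0)"
    by (intro sum.cong) auto
  then show ?thesis
    using assms by (simp add: sphere_geodesic_def)
qed

context
  fixes k :: nat and L :: real
  assumes k: "k \<ge> 1" and L: "L > 0"
begin

definition "tip_index p = (LEAST i. fst p i \<noteq> (0::real))" for p :: "(nat \<Rightarrow> real) \<times> real"

lemma tip_index_axis: "s \<noteq> 0 \<Longrightarrow> tip_index (axis_vector i s, t) = i"
  unfolding tip_index_def by (rule Least_equality) (auto split: if_splits)

interpretation sphere: edges_attached "unit_sphere k" "cross_polytope_vertices k" "sphere_geodesic k" L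
  by (rule edges_attached_sphere)

interpretation tips: cross_polytope k "\<lambda>i. (axis_vector i 1, L)" "\<lambda>i. (axis_vector i (-1), L)" tip_index
proof
  show "(axis_vector i 1, L) \<noteq> (axis_vector i (-1), L)" for i
    by (auto dest: fun_cong[of _ _ i])
qed (simp_all add: tip_index_axis)

abbreviation "T \<equiv> tips.W"

lemma T_cases:
  assumes "x \<in> T"
  obtains i s where "x = (axis_vector i s, L)" "i \<le> k" "s = 1 \<or> s = -1" "tip_index x = i"
  using assms unfolding tips.W_def by (auto simp: tip_index_axis)

lemma T_subset: "T \<subseteq> spiked_sphere k L"
proof
  fix x assume "x \<in> T"
  then obtain i s where x: "x = (axis_vector i s, L)" "i \<le> k" "s = 1 \<or> s = -1"
    by (rule T_cases)
  then have "axis_vector i s \<in> cross_polytope_vertices k"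
    by (auto simp: cross_polytope_vertices_def)
  then show "x \<in> spiked_sphere k L"
    using x L cross_polytope_vertices_subset by (auto simp: spiked_sphere_def attach_edges_def)
qed

lemma card_T: "card T \<le> 2 * k + 2"
proof -
  have "card T \<le> card ((\<lambda>i. (axis_vector i 1, L)) ` {..k}) + card ((\<lambda>i. (axis_vector i (-1), L)) ` {..k})"
    unfolding tips.W_def by (rule card_Un_le)
  also have "\<dots> \<le> Suc k + Suc k"
    by (intro add_mono order_trans[OF card_image_le]) auto
  finally show ?thesis by simp
qed

lemma dist_T:
  assumes x: "x \<in> T" and y: "y \<in> T"
  shows "spiked_sphere_dist k L x y = (if x = y then 0 else 2 * L + (if tip_index x = tip_index y then pi else pi / 2))"
proof -
  obtain i s where i: "x = (axis_vector i s, L)" "i \<le> k" "s = 1 \<or> s = -1" "tip_index x = i"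
    using x by (rule T_cases)
  obtain i' s' where i': "y = (axis_vector i' s', L)" "i' \<le> k" "s' = 1 \<or> s' = -1" "tip_index y = i'"
    using y by (rule T_cases)
  have eq: "axis_vector i s = axis_vector i' s' \<longleftrightarrow> i = i' \<and> s = s'"
  proof
    assume "axis_vector i s = axis_vector i' s'"
    from fun_cong[OF this, of i] show "i = i' \<and> s = s'"
      using i(3) by (auto split: if_splits)
  qed auto
  have "spiked_sphere_dist k L x y = glued_dist (sphere_geodesic k) x y"
    unfolding spiked_sphere_dist_def using T_subset x y
    by (intro sphere.attach_edges_dist_eq) (auto simp: spiked_sphere_def)
  also have "\<dots> = (if axis_vector i s = axis_vector i' s' then 0 else 2 * L + arccos (if i = i' then s * s' else 0))"
    using sphere_geodesic_axis_vectors[OF i(2), of s i' s'] by (simp add: glued_dist_def i(1) i'(1))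
  also have "\<dots> = (if x = y then 0 else 2 * L + (if i = i' then pi else pi / 2))"
    using i(3) i'(3) unfolding i(1) i'(1) prod.inject eq by auto
  finally show ?thesis using i(4) i'(4) by simp
qed

lemma vietoris_rips_T:
  assumes "pi / 2 + 2 * L \<le> r" "r < pi + 2 * L"
  shows "vietoris_rips T (spiked_sphere_dist k L) r = tips.C"
proof -
  have r: "spiked_sphere_dist k L x y \<le> r \<longleftrightarrow> x = y \<or> tip_index x \<noteq> tip_index y" if "x \<in> T" "y \<in> T" for x y
  proof -
    have "0 \<le> r"
      using assms L pi_gt_zero by linarith
    then show ?thesis
      using assms by (auto simp: dist_T[OF that])
  qed
  have "(\<forall>x\<in>\<sigma>. \<forall>y\<in>\<sigma>. spiked_sphere_dist k L x y \<le> r) \<longleftrightarrow> inj_on tip_index \<sigma>" if "\<sigma> \<subseteq> T" for \<sigma>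
    using r that unfolding inj_on_def by (meson subsetD)
  then show ?thesis
    unfolding vietoris_rips_def tips.C_def by (intro Collect_cong) blast
qed

lemma dgm_VR_T: "dgm_VR TYPE('f::field) k T (spiked_sphere_dist k L) (pi / 2 + 2 * L, ereal (pi + 2 * L)) = 1"
proof (rule dgm_VR_eq_1)
  fix s t :: real
  show "vr_rank TYPE('f) k T (spiked_sphere_dist k L) s t = 0" if "s < pi / 2 + 2 * L" "s \<le> t"
  proof (rule vr_rank_eq_0_if_discrete[OF that(2) k])
    show "s < spiked_sphere_dist k L x y" if "x \<in> T" "y \<in> T" "x \<noteq> y" for x y
    proof -
      have "s < pi + 2 * L"
        using \<open>s < pi / 2 + 2 * L\<close> pi_gt_zero by linarith
      then show ?thesis
        using \<open>s < pi / 2 + 2 * L\<close> that(3) unfolding dist_T[OF that(1,2)] by auto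
    qed
  qed
  show "vr_rank TYPE('f) k T (spiked_sphere_dist k L) s t = 1"
    if "pi / 2 + 2 * L \<le> s" "s \<le> t" "t < pi + 2 * L"
    using that by (simp add: vr_rank_def vietoris_rips_T tips.quotient_dim_cross_polytope)
  show "vr_rank TYPE('f) k T (spiked_sphere_dist k L) s t = 0" if "pi + 2 * L \<le> t" "s \<le> t"
  proof (rule vr_rank_eq_0_if_full[OF that(2)])
    show "spiked_sphere_dist k L x y \<le> t" if "x \<in> T" "y \<in> T" for x y
    proof -
      have "pi / 2 + 2 * L \<le> t" "0 \<le> t"
        using \<open>pi + 2 * L \<le> t\<close> pi_gt_zero L by linarith+
      then show ?thesis
        using \<open>pi + 2 * L \<le> t\<close> unfolding dist_T[OF that] by auto
    qed
  qed
qed (simp add: pi_gt_zero)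

lemma persistence_set_psubset:
  "persistence_set TYPE('f::field) (2 * k + 2) k (unit_sphere k) (sphere_geodesic k)
     \<subset> persistence_set TYPE('f) (2 * k + 2) k (spiked_sphere k L) (spiked_sphere_dist k L)"
proof
  let ?f = "\<lambda>x::nat \<Rightarrow> real. (x, 0::real)"
  have inj: "inj ?f" by (auto simp: inj_on_def)
  show "persistence_set TYPE('f) (2 * k + 2) k (unit_sphere k) (sphere_geodesic k)
      \<subseteq> persistence_set TYPE('f) (2 * k + 2) k (spiked_sphere k L) (spiked_sphere_dist k L)"
  proof
    fix D assume "D \<in> persistence_set TYPE('f) (2 * k + 2) k (unit_sphere k) (sphere_geodesic k)"
    then obtain X where X: "X \<subseteq> unit_sphere k" "finite X" "card X \<le> 2 * k + 2"
      and D: "D = dgm_VR TYPE('f) k X (sphere_geodesic k)"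
      by (auto simp: persistence_set_def)
    have "spiked_sphere_dist k L (?f x) (?f y) = sphere_geodesic k x y" if "x \<in> X" "y \<in> X" for x y
    proof -
      have "x \<in> unit_sphere k" "y \<in> unit_sphere k" using X that by auto
      then show ?thesis
        unfolding spiked_sphere_dist_def
        by (subst sphere.attach_edges_dist_eq) (auto simp: attach_edges_def glued_dist_def sphere.refl)
    qed
    then have "D = dgm_VR TYPE('f) k (?f ` X) (spiked_sphere_dist k L)"
      unfolding D by (rule dgm_VR_isometry[OF inj])
    moreover have "?f ` X \<subseteq> spiked_sphere k L"
      using X(1) by (auto simp: spiked_sphere_def attach_edges_def)
    moreover have "card (?f ` X) \<le> 2 * k + 2"
      using X(3) card_image_le[OF X(2), of ?f] by linarith
    ultimately show "D \<in> persistence_set TYPE('f) (2 * k + 2) k (spiked_sphere k L) (spiked_sphere_dist k L)"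
      using X(2) unfolding persistence_set_def by blast
  qed
  let ?D = "dgm_VR TYPE('f) k T (spiked_sphere_dist k L)"
  have "?D \<in> persistence_set TYPE('f) (2 * k + 2) k (spiked_sphere k L) (spiked_sphere_dist k L)"
    unfolding persistence_set_def using T_subset tips.finite_W card_T by blast
  moreover have "?D \<notin> persistence_set TYPE('f) (2 * k + 2) k (unit_sphere k) (sphere_geodesic k)"
  proof
    assume "?D \<in> persistence_set TYPE('f) (2 * k + 2) k (unit_sphere k) (sphere_geodesic k)"
    then obtain X where X: "X \<subseteq> unit_sphere k" and D: "?D = dgm_VR TYPE('f) k X (sphere_geodesic k)"
      by (auto simp: persistence_set_def)
    have "dgm_VR TYPE('f) k X (sphere_geodesic k) (pi / 2 + 2 * L, ereal (pi + 2 * L)) = 0"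
      using L pi_gt_zero X by (intro dgm_VR_eq_0[where \<delta> = pi] sphere_geodesic_bounds(2)[of _ k]) auto
    then show False
      using dgm_VR_T[where 'f = 'f] unfolding D by simp
  qed
  ultimately show "persistence_set TYPE('f) (2 * k + 2) k (unit_sphere k) (sphere_geodesic k)
      \<noteq> persistence_set TYPE('f) (2 * k + 2) k (spiked_sphere k L) (spiked_sphere_dist k L)"
    by blast
qed

end

theorem proposition7p8:
  fixes k :: nat and L :: real
  assumes "k \<ge> 1" and "L > 0"
  shows "(\<forall>j. dgm_VR TYPE('f::field) j (unit_sphere k) (sphere_geodesic k)
              = dgm_VR TYPE('f) j (spiked_sphere k L) (spiked_sphere_dist k L)) \<and>
         persistence_set TYPE('f) (2 * k + 2) k (unit_sphere k) (sphere_geodesic k)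
           \<subset> persistence_set TYPE('f) (2 * k + 2) k (spiked_sphere k L) (spiked_sphere_dist k L)"
proof (intro conjI allI)
  fix j
  interpret edges_attached "unit_sphere k" "cross_polytope_vertices k" "sphere_geodesic k" L
    by (rule edges_attached_sphere)
  show "dgm_VR TYPE('f) j (unit_sphere k) (sphere_geodesic k)
      = dgm_VR TYPE('f) j (spiked_sphere k L) (spiked_sphere_dist k L)"
    unfolding spiked_sphere_def spiked_sphere_dist_def by (rule dgm_VR_attach_edges)
qed (rule persistence_set_psubset[OF assms])

end
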